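(* Let $H<\mathrm{GL}(d,\mathbb{R})$ be an admissible dilation group with open dual orbit $\mathcal{O}$ (so that the quasi-regular representation $\pi$ of $G=\mathbb{R}^d\rtimes H$ is irreducible and square-integrable). Let $v$ be a weight on $G$ satisfying $v(x,h)\le(1+|x|)^sw(h)$ for all $(x,h)\in G$, for some $s\ge0$ and some weight $w$ on $H$. If $\psi\in\mathcal{F}^{-1}C_c^\infty(\mathcal{O})$, then there exists a relatively compact neighborhood $U\subset G$ of the identity such that $\mathrm{osc}_U(\mathcal{W}_\psi\psi)\in L^1_v(G)$.
   Context: Let $d>1$ and let $H$ be a closed subgroup of $\mathrm{GL}(d,\mathbb{R})$. $G=\mathbb{R}^d\rtimes H$ has product $(x,h)(y,g)=(x+hy,hg)$ and left Haar measure $|\det h|^{-1}\,dx\,dh$, with $dh$ left Haar measure on $H$. The quasi-regular representation is $[\pi(x,h)f](y)=|\det h|^{-1/2}f(h^{-1}(y-x))$ on $L^2(\mathbb{R}^d)$. $H$ is called an admissible dilation group if $\pi$ is irreducible and square-integrable, the latter meaning that there is a nonzero $\psi\in L^2(\mathbb{R}^d)$ with $(x,h)\mapsto\langle\psi,\pi(x,h)\psi\rangle$ in $L^2(G)$. It is known that this holds iff the dual action $(\xi,h)\mapsto h^T\xi$ has a single open orbit $\mathcal{O}=\{h^T\xi_0:h\in H\}\subset\mathbb{R}^d$ of full Lebesgue measure, with compact stabilizers; $\mathcal{O}$ is called the open dual orbit. The wavelet transform is $\mathcal{W}_\psi f(x,h)=\langle f,\pi(x,h)\psi\rangle$. The Fourier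 transform is $\mathcal{F}f(\xi)=\widehat f(\xi)=\int f(x)e^{-2\pi i\langle x,\xi\rangle}dx$. $C_c^\infty(\mathcal{O})$ is the space of $f\in C_c^\infty(\mathbb{R}^d)$ with support contained in $\mathcal{O}$, and $\mathcal{F}^{-1}C_c^\infty(\mathcal{O})$ is its inverse image under the Fourier transform. A weight on a locally compact group is a continuous positive submultiplicative function. $L^1_v(G)$ is the space of measurable $F$ with $\int_H\int_{\mathbb{R}^d}|F(x,h)|v(x,h)\,dx\,\frac{dh}{|\det h|}<\infty$. For a relatively compact neighborhood $U\subset G$ of the identity and $F:G\to\mathbb{C}$, $\mathrm{osc}_U(F)(z)=\sup\{|F(z)-F(zy)|:y\in U\}$ for $z\in G$. *)

theory Defs
  imports "HOL-Analysis.Analysis"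
begin

section \<open>Closed matrix groups and the semidirect product\<close>

definition closed_matrix_group :: "(real^'n^'n) set \<Rightarrow> bool" where
  "closed_matrix_group H \<longleftrightarrow>
     closedin (top_of_set {A. invertible A}) H \<and>
     mat 1 \<in> H \<and>
     (\<forall>g\<in>H. \<forall>h\<in>H. g ** h \<in> H) \<and>
     (\<forall>h\<in>H. matrix_inv h \<in> H)"

definition sd_carrier :: "(real^'n^'n) set \<Rightarrow> ((real^'n) \<times> (real^'n^'n)) set" where
  "sd_carrier H = UNIV \<times> H"

definition sd_mult ::
  "(real^'n) \<times> (real^'n^'n) \<Rightarrow> (real^'n) \<times> (real^'n^'n) \<Rightarrow> (real^'n) \<times> (real^'n^'n)" where
  "sd_mult z z' = (fst z + snd z *v fst z', snd z ** snd z')"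

definition sd_one :: "(real^'n) \<times> (real^'n^'n)" where
  "sd_one = (0, mat 1)"

definition rel_compact_nbhd :: "(real^'n^'n) set \<Rightarrow> ((real^'n) \<times> (real^'n^'n)) set \<Rightarrow> bool" where
  "rel_compact_nbhd H U \<longleftrightarrow>
     U \<subseteq> sd_carrier H \<and>
     sd_one \<in> top_of_set (sd_carrier H) interior_of U \<and>
     compactin (top_of_set (sd_carrier H)) (top_of_set (sd_carrier H) closure_of U)"

definition weight_on :: "'g::topological_space set \<Rightarrow> ('g \<Rightarrow> 'g \<Rightarrow> 'g) \<Rightarrow> ('g \<Rightarrow> real) \<Rightarrow> bool" where
  "weight_on G m v \<longleftrightarrow>
     continuous_on G v \<and>
     (\<forall>z\<in>G. 0 < v z) \<and>
     (\<forall>z\<in>G. \<forall>z'\<in>G. v (m z z') \<le> v z * v z')"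

section \<open>Haar measures\<close>

text \<open>A closed matrix group is locally compact and second countable, so a Borel measure on it
  that is finite on compact sets is automatically a Radon measure; no regularity clause is
  needed.\<close>

definition left_haar_measure :: "(real^'n^'n) set \<Rightarrow> (real^'n^'n) measure \<Rightarrow> bool" where
  "left_haar_measure H \<mu> \<longleftrightarrow>
     sets \<mu> = sets (restrict_space borel H) \<and>
     emeasure \<mu> H \<noteq> 0 \<and>
     (\<forall>K. compact K \<and> K \<subseteq> H \<longrightarrow> emeasure \<mu> K < \<infinity>) \<and>
     (\<forall>h\<in>H. \<forall>A\<in>sets \<mu>. emeasure \<mu> ((**) h ` A) = emeasure \<mu> A)"

definition sd_haar :: "(real^'n^'n) measure \<Rightarrow> ((real^'n) \<times> (real^'n^'n)) measure" where
  "sd_haar \<mu> = density (lborel \<Otimes>\<^sub>M \<mu>) (\<lambda>(x, h). ennreal (1 / \<bar>det h\<bar>))"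

section \<open>The quasi-regular representation\<close>

text \<open>Elements of \<open>L\<^sup>2\<close> are represented by functions, not by classes of functions modulo null
  sets.\<close>

definition L2_fun :: "'a measure \<Rightarrow> ('a \<Rightarrow> complex) set" where
  "L2_fun M = {f \<in> borel_measurable M. integrable M (\<lambda>x. (cmod (f x))\<^sup>2)}"

definition L2_inner :: "(real^'n \<Rightarrow> complex) \<Rightarrow> (real^'n \<Rightarrow> complex) \<Rightarrow> complex" where
  "L2_inner f g = (LINT y|lborel. f y * cnj (g y))"

definition quasi_regular ::
  "(real^'n) \<times> (real^'n^'n) \<Rightarrow> (real^'n \<Rightarrow> complex) \<Rightarrow> real^'n \<Rightarrow> complex" where
  "quasi_regular z f =
     (\<lambda>y. complex_of_real (\<bar>det (snd z)\<bar> powr (- 1/2)) * f (matrix_inv (snd z) *v (y - fst z)))"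

definition wavelet_transform ::
  "(real^'n \<Rightarrow> complex) \<Rightarrow> (real^'n \<Rightarrow> complex) \<Rightarrow> (real^'n) \<times> (real^'n^'n) \<Rightarrow> complex" where
  "wavelet_transform \<psi> f z = L2_inner f (quasi_regular z \<psi>)"

text \<open>The last clause, applied to constant sequences, makes a closed subspace saturated under
  almost everywhere equality, so these sets are exactly the preimages of the closed subspaces of
  the quotient space.\<close>

definition L2_closed_subspace :: "(real^'n \<Rightarrow> complex) set \<Rightarrow> bool" where
  "L2_closed_subspace V \<longleftrightarrow>
     V \<subseteq> L2_fun lborel \<and>
     (\<lambda>_. 0) \<in> V \<and>
     (\<forall>f\<in>V. \<forall>g\<in>V. (\<lambda>x. f x + g x) \<in> V) \<and>
     (\<forall>c. \<forall>f\<in>V. (\<lambda>x. c * f x) \<in> V) \<and>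
     (\<forall>F. \<forall>f\<in>L2_fun lborel.
        (\<forall>k. F k \<in> V) \<and> (\<lambda>k::nat. LINT x|lborel. (cmod (F k x - f x))\<^sup>2) \<longlonglongrightarrow> 0 \<longrightarrow> f \<in> V)"

definition quasi_regular_irreducible :: "(real^'n^'n) set \<Rightarrow> bool" where
  "quasi_regular_irreducible H \<longleftrightarrow>
     (\<forall>V. L2_closed_subspace V \<and> (\<forall>z\<in>sd_carrier H. \<forall>f\<in>V. quasi_regular z f \<in> V) \<longrightarrow>
        V = {f \<in> L2_fun lborel. AE x in lborel. f x = 0} \<or> V = L2_fun lborel)"

definition quasi_regular_square_integrable :: "(real^'n^'n) measure \<Rightarrow> bool" where
  "quasi_regular_square_integrable \<mu> \<longleftrightarrow>
     (\<exists>\<psi>\<in>L2_fun lborel. \<not> (AE x in lborel. \<psi> x = 0) \<and>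
        wavelet_transform \<psi> \<psi> \<in> L2_fun (sd_haar \<mu>))"

definition admissible_dilation_group ::
  "(real^'n^'n) set \<Rightarrow> (real^'n^'n) measure \<Rightarrow> bool" where
  "admissible_dilation_group H \<mu> \<longleftrightarrow>
     closed_matrix_group H \<and> left_haar_measure H \<mu> \<and>
     quasi_regular_irreducible H \<and> quasi_regular_square_integrable \<mu>"

section \<open>The dual action\<close>

definition dual_orbit :: "(real^'n^'n) set \<Rightarrow> real^'n \<Rightarrow> (real^'n) set" where
  "dual_orbit H \<xi> = (\<lambda>h. transpose h *v \<xi>) ` H"

definition dual_stabilizer :: "(real^'n^'n) set \<Rightarrow> real^'n \<Rightarrow> (real^'n^'n) set" where
  "dual_stabilizer H \<xi> = {h\<in>H. transpose h *v \<xi> = \<xi>}"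

text \<open>A dilation group is admissible if and only if it has such an orbit, which is then unique; so for
  an admissible \<open>H\<close> the predicate only names the orbit.\<close>

definition open_dual_orbit :: "(real^'n^'n) set \<Rightarrow> (real^'n) set \<Rightarrow> bool" where
  "open_dual_orbit H Orb \<longleftrightarrow>
     (\<exists>\<xi>\<^sub>0. Orb = dual_orbit H \<xi>\<^sub>0) \<and>
     open Orb \<and>
     (\<forall>\<xi>. open (dual_orbit H \<xi>) \<longrightarrow> dual_orbit H \<xi> = Orb) \<and>
     - Orb \<in> null_sets lborel \<and>
     (\<forall>\<xi>\<in>Orb. compact (dual_stabilizer H \<xi>))"

section \<open>Test functions and the Fourier transform\<close>

primrec C_k :: "nat \<Rightarrow> ('a::euclidean_space \<Rightarrow> complex) \<Rightarrow> bool" where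
  "C_k 0 f \<longleftrightarrow> continuous_on UNIV f"
| "C_k (Suc k) f \<longleftrightarrow>
     (\<forall>x. f differentiable (at x)) \<and> (\<forall>u. C_k k (\<lambda>x. frechet_derivative f (at x) u))"

definition test_functions :: "('a::euclidean_space) set \<Rightarrow> ('a \<Rightarrow> complex) set" where
  "test_functions S =
     {f. (\<forall>k. C_k k f) \<and> compact (closure {x. f x \<noteq> 0}) \<and> closure {x. f x \<noteq> 0} \<subseteq> S}"

definition fourier :: "('a::euclidean_space \<Rightarrow> complex) \<Rightarrow> 'a \<Rightarrow> complex" where
  "fourier f \<xi> = (LINT x|lborel. f x * exp (- 2 * complex_of_real pi * \<i> * complex_of_real (x \<bullet> \<xi>)))"

text \<open>By Fourier inversion every element of this set agrees almost everywhere with a Schwartz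
  function, so requiring integrability (rather than membership in \<open>L\<^sup>2\<close> or the space of tempered
  distributions) loses nothing.\<close>

definition fourier_test_functions :: "('a::euclidean_space) set \<Rightarrow> ('a \<Rightarrow> complex) set" where
  "fourier_test_functions S = {f. integrable lborel f \<and> fourier f \<in> test_functions S}"

section \<open>Oscillation and weighted integrability\<close>

text \<open>The supremum is taken in the reals, so it is meaningful for bounded \<open>F\<close>. A transform
  \<open>wavelet_transform \<psi> \<psi>\<close> with square-integrable \<open>\<psi>\<close> is bounded by the Cauchy-Schwarz
  inequality.\<close>

definition oscillation ::
  "((real^'n) \<times> (real^'n^'n)) set \<Rightarrow> ((real^'n) \<times> (real^'n^'n) \<Rightarrow> complex) \<Rightarrow>
   (real^'n) \<times> (real^'n^'n) \<Rightarrow> real" where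
  "oscillation U F z = (SUP y\<in>U. cmod (F z - F (sd_mult z y)))"

definition L1_weighted ::
  "(real^'n^'n) measure \<Rightarrow> ((real^'n) \<times> (real^'n^'n) \<Rightarrow> real) \<Rightarrow>
   ((real^'n) \<times> (real^'n^'n) \<Rightarrow> 'b::real_normed_vector) set" where
  "L1_weighted \<mu> v =
     {F \<in> borel_measurable (sd_haar \<mu>). (\<integral>\<^sup>+z. ennreal (norm (F z) * v z) \<partial>sd_haar \<mu>) < \<infinity>}"

end

theory Submission
  imports Defs "HOL-Probability.Characteristic_Functions" "HOL-Probability.Sinc_Integral"
begin

text \<open>
  The oscillation can be bounded without any cancellation between \<open>W z\<close> and \<open>W (z y)\<close>. The function
  \<open>W = wavelet_transform \<psi> \<psi>\<close> vanishes unless \<open>h\<close> lies in a fixed compact subset of \<open>H\<close>, it decays faster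
  than every power of \<open>1 + \<bar>x\<bar>\<close> uniformly in \<open>h\<close>, and right translation by a compact neighbourhood
  \<open>U\<close> only enlarges the compact set and the constants. So the oscillation over \<open>U\<close>, which is at most
  \<open>\<bar>W z\<bar>\<close> plus the supremum of \<open>\<bar>W (z y)\<bar>\<close>, has the same two properties. On a compact set of \<open>h\<close> the weight
  is at most a constant times \<open>(1 + \<bar>x\<bar>)\<^sup>s\<close>, and integrability follows
  (\<open>L1_weightedI_compact_support\<close>).

  Compact support in \<open>h\<close>: write \<open>\<phi>\<close> for the Fourier transform of \<open>\<psi>\<close> and \<open>K\<close> for its support. On the
  Fourier side \<open>W (x, h)\<close> is \<open>\<bar>det h\<bar>\<^sup>1\<^sup>/\<^sup>2\<close> times the integral of
  \<open>\<phi> \<xi> * cnj (\<phi> (h\<^sup>T \<xi>)) * cis (2 * pi * (x \<bullet> \<xi>))\<close> (\<open>wavelet_transform_fourier\<close>), so it vanishes unless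
  \<open>h\<^sup>T\<close> maps some point of \<open>K\<close> into \<open>K\<close>. Such \<open>h\<close> form a relatively compact set because \<open>H\<close> acts properly on
  the open orbit (\<open>dual_action_proper\<close>): by the Baire category theorem a compact part of \<open>H\<close> already
  sweeps out \<open>K\<close>, and the remaining freedom is a compact stabiliser.

  Decay in \<open>x\<close>: by Fourier inversion (\<open>AE_eq_inverse_fourier\<close>) \<open>\<psi>\<close> agrees almost everywhere with the
  inverse Fourier transform \<open>f\<close> of \<open>\<phi>\<close>, which is rapidly decreasing because \<open>\<phi>\<close> is smooth with compact
  support. The formula above involves \<open>\<psi>\<close> only through \<open>\<phi>\<close>, so \<open>f\<close> may replace \<open>\<psi>\<close> in \<open>W\<close>. The defining
  integral of \<open>W\<close> is then a twisted convolution of rapidly decreasing functions, which gives the decay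
  with constants that are locally bounded in \<open>h\<close> (\<open>wavelet_transform_decay\<close>).

  Measurability of the oscillation holds because it is a supremum of continuous functions, hence
  lower semicontinuous (\<open>oscillation_greater_open\<close>).
\<close>

section \<open>Linear changes of variables\<close>

lemma borel_measurable_matrix_vector_mult [measurable]:
  "(*v) (A :: real^'n^'m) \<in> borel_measurable borel"
  by (intro borel_measurable_continuous_onI linear_continuous_on) simp

text \<open>Integrate over the coordinate \<open>i\<close> first: for fixed other coordinates the shear is a translation
  of that coordinate, which leaves the inner integral unchanged.\<close>
lemma nn_integral_lborel_shear:
  fixes i :: "'a::euclidean_space" and g :: "'a \<Rightarrow> real"
  assumes i: "i \<in> Basis"
    and f [measurable]: "f \<in> borel_measurable borel"
    and g [measurable]: "g \<in> borel_measurable borel"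
    and indep: "\<And>x t. g (x + t *\<^sub>R i) = g x"
  shows "(\<integral>\<^sup>+x. f (x + g x *\<^sub>R i) \<partial>lborel) = (\<integral>\<^sup>+x. f x \<partial>lborel)"
proof -
  interpret product_sigma_finite "\<lambda>b::'a. lborel :: real measure" ..
  have B: "Basis = insert i (Basis - {i})" using i by auto
  have coord: "(\<integral>\<^sup>+x. F x \<partial>lborel) =
      (\<integral>\<^sup>+x. (\<integral>\<^sup>+t. F ((\<Sum>b\<in>Basis - {i}. x b *\<^sub>R b) + t *\<^sub>R i) \<partial>lborel)
         \<partial>(\<Pi>\<^sub>M b\<in>Basis - {i}. lborel))"
    if F [measurable]: "F \<in> borel_measurable borel" for F :: "'a \<Rightarrow> ennreal"
  proof -
    have "(\<integral>\<^sup>+x. F x \<partial>lborel) = (\<integral>\<^sup>+x. F (\<Sum>b\<in>Basis. x b *\<^sub>R b) \<partial>(\<Pi>\<^sub>M b\<in>Basis. lborel))"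
      by (subst lborel_eq) (simp add: nn_integral_distr)
    also have "\<dots> = (\<integral>\<^sup>+x. F (\<Sum>b\<in>Basis. x b *\<^sub>R b) \<partial>(\<Pi>\<^sub>M b\<in>insert i (Basis - {i}). lborel))"
      using B by simp
    also have "\<dots> = (\<integral>\<^sup>+x. (\<integral>\<^sup>+t. F (\<Sum>b\<in>Basis. (x(i := t)) b *\<^sub>R b) \<partial>lborel)
         \<partial>(\<Pi>\<^sub>M b\<in>Basis - {i}. lborel))"
      by (rule product_nn_integral_insert) (use B in auto)
    also have "(\<lambda>x t. (\<Sum>b\<in>Basis. (x(i := t)) b *\<^sub>R b)) =
       (\<lambda>x t. (\<Sum>b\<in>Basis - {i}. x b *\<^sub>R b) + t *\<^sub>R i)"
      by (intro ext, subst sum.remove[OF finite_Basis i]) (simp add: add.commute)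
    finally show ?thesis by (simp add: fun_eq_iff)
  qed
  have shift: "(\<integral>\<^sup>+t. f (y + (t + c) *\<^sub>R i) \<partial>lborel) = (\<integral>\<^sup>+t. f (y + t *\<^sub>R i) \<partial>lborel)" for y c
    using nn_integral_real_affine[of "\<lambda>t. f (y + t *\<^sub>R i)" 1 c] by (simp add: add.commute)
  have "(\<integral>\<^sup>+x. f (x + g x *\<^sub>R i) \<partial>lborel) =
      (\<integral>\<^sup>+x. (\<integral>\<^sup>+t. f ((\<Sum>b\<in>Basis - {i}. x b *\<^sub>R b) + (t + g (\<Sum>b\<in>Basis - {i}. x b *\<^sub>R b)) *\<^sub>R i) \<partial>lborel)
         \<partial>(\<Pi>\<^sub>M b\<in>Basis - {i}. lborel))"
    by (subst coord) (simp_all add: indep add.assoc scaleR_left_distrib)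
  also have "\<dots> = (\<integral>\<^sup>+x. f x \<partial>lborel)"
    by (simp add: shift coord)
  finally show ?thesis .
qed

text \<open>The identity is multiplicative in the matrix, so it suffices to prove it for the elementary
  matrices: diagonal matrices scale the coordinates, transpositions permute the sides of boxes, and
  elementary row operations are shears. Singular matrices enter the induction only through the
  premise \<open>det A \<noteq> 0\<close>, which they make false.\<close>
lemma nn_integral_lborel_matrix:
  fixes A :: "real^'n^'n"
  assumes "det A \<noteq> 0" and "f \<in> borel_measurable borel"
  shows "(\<integral>\<^sup>+x. f x \<partial>lborel) = ennreal \<bar>det A\<bar> * (\<integral>\<^sup>+x. f (A *v x) \<partial>lborel)"
proof -
  \<comment> \<open>\<open>f\<close> is quantified inside \<open>P\<close>, since a product of matrices applies the claim to \<open>\<lambda>x. f (A *v x)\<close>.\<close>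
  define P :: "real^'n^'n \<Rightarrow> bool" where "P A \<longleftrightarrow> (det A \<noteq> 0 \<longrightarrow> (\<forall>f \<in> borel_measurable borel.
     (\<integral>\<^sup>+x. f x \<partial>lborel) = ennreal \<bar>det A\<bar> * (\<integral>\<^sup>+x. f (A *v x) \<partial>lborel)))" for A
  have "P A"
  proof (rule induct_matrix_elementary)
    fix A B :: "real^'n^'n" assume A: "P A" and B: "P B"
    show "P (A ** B)"
      unfolding P_def
    proof (intro impI ballI)
      fix f :: "real^'n \<Rightarrow> ennreal"
      assume d: "det (A ** B) \<noteq> 0" and f [measurable]: "f \<in> borel_measurable borel"
      from d have dA: "det A \<noteq> 0" and dB: "det B \<noteq> 0" by (auto simp: det_mul)
      have "(\<integral>\<^sup>+x. f x \<partial>lborel) = ennreal \<bar>det A\<bar> * (\<integral>\<^sup>+x. f (A *v x) \<partial>lborel)"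
        using A dA f unfolding P_def by blast
      also have "(\<integral>\<^sup>+x. f (A *v x) \<partial>lborel) = ennreal \<bar>det B\<bar> * (\<integral>\<^sup>+x. f (A *v (B *v x)) \<partial>lborel)"
        using B dB unfolding P_def by (elim impE bspec) measurable
      finally show "(\<integral>\<^sup>+x. f x \<partial>lborel) = ennreal \<bar>det (A ** B)\<bar> * (\<integral>\<^sup>+x. f (A ** B *v x) \<partial>lborel)"
        by (simp add: det_mul abs_mult ennreal_mult matrix_vector_mul_assoc mult.assoc)
    qed
  next
    fix A :: "real^'n^'n" and i assume "row i A = 0"
    then show "P A" by (simp add: P_def det_zero_row)
  next
    fix A :: "real^'n^'n" assume D: "\<And>i j. i \<noteq> j \<Longrightarrow> A $ i $ j = 0"
    have det: "det A = (\<Prod>i\<in>UNIV. A $ i $ i)" using D by (rule det_diagonal)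
    let ?c = "\<lambda>j::real^'n. (\<Sum>i\<in>UNIV. A $ i $ i * j $ i)"
    have c_axis: "?c (axis k 1) = A $ k $ k" for k
      by (simp add: axis_def if_distrib cong: if_cong)
    \<comment> \<open>This is the form in which \<open>lborel_affine_euclidean\<close> expresses a coordinatewise scaling.\<close>
    have Av: "A *v x = 0 + (\<Sum>j\<in>Basis. (?c j * (x \<bullet> j)) *\<^sub>R j)" for x
    proof -
      have "(A *v x) $ k = A $ k $ k * x $ k" for k
        unfolding matrix_vector_mult_def
        by (simp, subst sum.remove[of _ k]) (auto simp: D intro!: sum.neutral)
      then have "(A *v x) = (\<Sum>k\<in>UNIV. (A $ k $ k * x $ k) *\<^sub>R axis k 1)"
        by (simp add: vec_eq_iff axis_def if_distrib cong: if_cong)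
      also have "\<dots> = (\<Sum>j\<in>Basis. (?c j * (x \<bullet> j)) *\<^sub>R j)"
        unfolding Basis_vec_def
        by (subst sum.UNION_disjoint) (auto simp: axis_eq_axis inner_axis c_axis)
      finally show ?thesis by simp
    qed
    show "P A"
      unfolding P_def
    proof (intro impI ballI)
      fix f :: "real^'n \<Rightarrow> ennreal"
      assume d: "det A \<noteq> 0" and f [measurable]: "f \<in> borel_measurable borel"
      have nz: "?c j \<noteq> 0" if "j \<in> Basis" for j
        using that d unfolding det Basis_vec_def by (auto simp: c_axis)
      have prod: "(\<Prod>j\<in>Basis. \<bar>?c j\<bar>) = \<bar>det A\<bar>"
        unfolding Basis_vec_def det abs_prod
        by (subst prod.UNION_disjoint) (auto simp: axis_eq_axis c_axis)
      have "(lborel :: (real^'n) measure) = density (distr lborel borel ((*v) A)) (\<lambda>_. ennreal \<bar>det A\<bar>)"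
        using lborel_affine_euclidean[of ?c 0, OF nz] unfolding Av[symmetric] prod .
      then have "(\<integral>\<^sup>+x. f x \<partial>lborel) = (\<integral>\<^sup>+x. f x \<partial>density (distr lborel borel ((*v) A)) (\<lambda>_. ennreal \<bar>det A\<bar>))"
        by simp
      also have "\<dots> = ennreal \<bar>det A\<bar> * (\<integral>\<^sup>+x. f (A *v x) \<partial>lborel)"
        by (simp add: nn_integral_density nn_integral_distr nn_integral_cmult)
      finally show "(\<integral>\<^sup>+x. f x \<partial>lborel) = ennreal \<bar>det A\<bar> * (\<integral>\<^sup>+x. f (A *v x) \<partial>lborel)" .
    qed
  next
    fix m n :: 'n assume mn: "m \<noteq> n"
    let ?\<tau> = "Transposition.transpose m n"
    let ?A = "\<chi> i j. (mat 1 :: real^'n^'n) $ i $ ?\<tau> j"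
    have det: "\<bar>det ?A\<bar> = 1"
      using mn by (simp add: det_permute_columns permutes_swap_id sign_swap_id abs_mult)
    have Av: "(?A *v x) $ i = x $ ?\<tau> i" for x i
    proof -
      have "(?A *v x) $ i = (\<Sum>j\<in>UNIV. if j = ?\<tau> i then x $ j else 0)"
        unfolding matrix_vector_mult_def mat_def vec_lambda_beta
        by (intro sum.cong refl) (auto simp: transpose_eq_iff)
      then show ?thesis by simp
    qed
    have "lborel = distr (lborel :: (real^'n) measure) borel ((*v) ?A)"
    proof (rule lborel_eqI)
      fix l u :: "real^'n" assume le: "\<And>b. b \<in> Basis \<Longrightarrow> l \<bullet> b \<le> u \<bullet> b"
      have le': "l $ i \<le> u $ i" for i
        using le[of "axis i 1"] by (simp add: inner_axis)
      let ?s = "\<lambda>x::real^'n. (\<chi> i. x $ ?\<tau> i)"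
      have "(*v) ?A -` box l u = box (?s l) (?s u)"
        unfolding set_eq_iff vimage_def mem_Collect_eq mem_box_cart Av vec_lambda_beta
        by (metis transpose_involutory)
      moreover have "emeasure lborel (box (?s l) (?s u)) = (\<Prod>b\<in>Basis. (?s u - ?s l) \<bullet> b)"
        using le' by (subst emeasure_lborel_box) (auto simp: Basis_vec_def inner_axis)
      moreover have "(\<Prod>b\<in>Basis. (?s u - ?s l) \<bullet> b) = (\<Prod>b\<in>Basis. (u - l) \<bullet> b)"
      proof -
        have bprod: "(\<Prod>b\<in>Basis. x \<bullet> b) = (\<Prod>i\<in>UNIV. x $ i)" for x :: "real^'n"
          unfolding Basis_vec_def by (subst prod.UNION_disjoint) (auto simp: axis_eq_axis inner_axis)
        have "(\<Prod>i\<in>UNIV. (u - l) $ ?\<tau> i) = (\<Prod>i\<in>UNIV. (u - l) $ i)"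
          by (rule prod.reindex_bij_betw[of ?\<tau>]) (simp add: bij_betw_def)
        then show ?thesis unfolding bprod by simp
      qed
      ultimately show "emeasure (distr lborel borel ((*v) ?A)) (box l u) = (\<Prod>b\<in>Basis. (u - l) \<bullet> b)"
        by (simp add: emeasure_distr)
    qed simp
    then have "(\<integral>\<^sup>+x. f x \<partial>lborel) = (\<integral>\<^sup>+x. f (?A *v x) \<partial>lborel)"
      if [measurable]: "f \<in> borel_measurable borel" for f :: "real^'n \<Rightarrow> ennreal"
      using nn_integral_distr[of "(*v) ?A" lborel borel f] by simp
    then show "P ?A"
      unfolding P_def det abs_one ennreal_1 mult_1 by blast
  next
    fix m n :: 'n and c :: real assume mn: "m \<noteq> n"
    let ?A = "\<chi> i j. if i = m \<and> j = n then c else of_bool (i = j)"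
    have "?A = (\<chi> k. if k = m then row m (mat 1) + c *s row n (mat 1) else row k (mat 1))"
      using mn by (auto simp: vec_eq_iff row_def mat_def)
    then have det: "det ?A = 1"
      using det_row_operation[OF mn, of "mat 1" c] by simp
    have Av: "?A *v x = x + (c * x $ n) *\<^sub>R axis m 1" for x
    proof -
      have "(?A *v x) $ i = (x + (c * x $ n) *\<^sub>R axis m 1) $ i" for i
      proof -
        have "(?A *v x) $ i = (\<Sum>j\<in>UNIV. (if j = i then x $ j else 0) + (if j = n then (if i = m then c * x $ n else 0) else 0))"
          unfolding matrix_vector_mult_def vec_lambda_beta
          using mn by (intro sum.cong refl) auto
        then show ?thesis by (simp add: sum.distrib axis_def)
      qed
      then show ?thesis by (simp add: vec_eq_iff)
    qed
    have "(\<integral>\<^sup>+x. f x \<partial>lborel) = (\<integral>\<^sup>+x. f (?A *v x) \<partial>lborel)"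
      if [measurable]: "f \<in> borel_measurable borel" for f :: "real^'n \<Rightarrow> ennreal"
      unfolding Av
    proof (rule nn_integral_lborel_shear[symmetric])
      show "(\<lambda>x::real^'n. c * x $ n) \<in> borel_measurable borel"
        by (intro borel_measurable_continuous_onI continuous_intros)
      show "axis m 1 \<in> (Basis :: (real^'n) set)" by simp
      show "c * (x + t *\<^sub>R axis m 1) $ n = c * x $ n" for x :: "real^'n" and t
        using mn by (simp add: axis_def)
    qed simp
    then show "P ?A"
      unfolding P_def det abs_one ennreal_1 mult_1 by blast
  qed
  with assms show ?thesis unfolding P_def by blast
qed

lemma lborel_matrix_affine:
  fixes A :: "real^'n^'n"
  assumes "det A \<noteq> 0"
  shows "lborel = density (distr lborel borel (\<lambda>x. b + A *v x)) (\<lambda>_. ennreal \<bar>det A\<bar>)"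
proof (rule measure_eqI)
  fix S :: "(real^'n) set" assume "S \<in> sets lborel"
  then have [measurable]: "S \<in> sets borel" by simp
  have "emeasure lborel S = emeasure (distr lborel borel ((+) b)) S"
    by (simp add: lborel_distr_plus)
  also have "\<dots> = (\<integral>\<^sup>+x. indicator S (b + x) \<partial>lborel)"
    by (subst nn_integral_distr[symmetric, of _ _ borel]) (auto simp: )
  also have "\<dots> = ennreal \<bar>det A\<bar> * (\<integral>\<^sup>+x. indicator S (b + A *v x) \<partial>lborel)"
    by (rule nn_integral_lborel_matrix) (use assms in auto)
  also have "\<dots> = emeasure (density (distr lborel borel (\<lambda>x. b + A *v x)) (\<lambda>_. ennreal \<bar>det A\<bar>)) S"
    by (simp add: emeasure_density nn_integral_cmult nn_integral_distr del: nn_integral_indicator)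
  finally show "emeasure lborel S = \<dots>" .
qed simp

lemma
  fixes A :: "real^'n^'n" and f :: "real^'n \<Rightarrow> 'b::{banach, second_countable_topology}"
  assumes "det A \<noteq> 0" and [measurable]: "f \<in> borel_measurable borel"
  shows integral_lborel_matrix_affine: 
      "(\<integral>x. f x \<partial>lborel) = \<bar>det A\<bar> *\<^sub>R (\<integral>x. f (b + A *v x) \<partial>lborel)"
    and integrable_lborel_matrix_affine: 
      "integrable lborel (\<lambda>x. f (b + A *v x)) \<longleftrightarrow> integrable lborel f"
proof -
  show "(\<integral>x. f x \<partial>lborel) = \<bar>det A\<bar> *\<^sub>R (\<integral>x. f (b + A *v x) \<partial>lborel)"
    by (subst lborel_matrix_affine[OF assms(1), of b])
       (simp add: integral_density integral_distr)
  show "integrable lborel (\<lambda>x. f (b + A *v x)) \<longleftrightarrow> integrable lborel f"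
    using assms(1) integrable_scaleR_right[of "inverse \<bar>det A\<bar>" lborel "\<lambda>x. \<bar>det A\<bar> *\<^sub>R f (b + A *v x)"]
    by (subst (2) lborel_matrix_affine[OF assms(1), of b])
       (auto simp add: integrable_density integrable_distr_eq intro: integrable_scaleR_right)
qed

section \<open>Gaussian integrals\<close>

lemma borel_measurable_cis [measurable]: "cis \<in> borel_measurable borel"
  by (intro borel_measurable_continuous_onI continuous_intros)

lemma
  fixes f :: "'a::euclidean_space \<Rightarrow> real \<Rightarrow> 'b::{real_normed_field,banach,second_countable_topology}"
  assumes f: "\<And>b. integrable lborel (f b)"
  shows integrable_lborel_prod: "integrable lborel (\<lambda>x. \<Prod>b\<in>Basis. f b (x \<bullet> b))"
    and integral_lborel_prod:
      "(\<integral>x. (\<Prod>b\<in>Basis. f b (x \<bullet> b)) \<partial>lborel) = (\<Prod>b\<in>Basis. \<integral>t. f b t \<partial>lborel)"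
proof -
  interpret product_sigma_finite "\<lambda>b::'a. lborel :: real measure" ..
  have [measurable]: "f b \<in> borel_measurable borel" for b
    using borel_measurable_integrable[OF f[of b]] by simp
  show "integrable lborel (\<lambda>x. \<Prod>b\<in>Basis. f b (x \<bullet> b))"
    by (subst lborel_eq) (simp add: integrable_distr_eq product_integrable_prod f)
  show "(\<integral>x. (\<Prod>b\<in>Basis. f b (x \<bullet> b)) \<partial>lborel) = (\<Prod>b\<in>Basis. \<integral>t. f b t \<partial>lborel)"
    by (subst lborel_eq) (simp add: integral_distr product_integral_prod f)
qed

definition gaussian :: "'a::euclidean_space \<Rightarrow> real" where
  "gaussian x = exp (- (norm x)\<^sup>2 / 2)"

text \<open>The product form reduces all Gaussian integrals to one dimension.\<close>
lemma gaussian_eq_prod: "gaussian x = (\<Prod>b\<in>Basis. exp (- (x \<bullet> b)\<^sup>2 / 2))"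
proof -
  have "- (norm x)\<^sup>2 / 2 = (\<Sum>b\<in>Basis. - (x \<bullet> b)\<^sup>2 / 2)"
    unfolding power2_norm_eq_inner
    by (subst euclidean_inner) (simp add: power2_eq_square sum_negf sum_divide_distrib)
  then show ?thesis
    unfolding gaussian_def by (simp add: exp_sum)
qed

lemma gaussian_bounds: "0 < gaussian x" "gaussian x \<le> 1"
  by (auto simp: gaussian_def)

lemma borel_measurable_gaussian [measurable]: "gaussian \<in> borel_measurable borel"
  unfolding gaussian_def by measurable

text \<open>The second claim is the characteristic function of the standard normal distribution, rescaled.\<close>
lemma
  shows integrable_gaussian_real: "integrable lborel (\<lambda>t::real. exp (- t\<^sup>2 / 2))"
    and integral_gaussian_cis_real:
      "(\<integral>t. complex_of_real (exp (- t\<^sup>2 / 2)) * cis (s * t) \<partial>lborel) = sqrt (2 * pi) * exp (- s\<^sup>2 / 2)"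
proof -
  have eq: "exp (- t\<^sup>2 / 2) = sqrt (2 * pi) * std_normal_density t" for t
    by (simp add: std_normal_density_def)
  show "integrable lborel (\<lambda>t::real. exp (- t\<^sup>2 / 2))"
    unfolding eq by simp
  have "complex_of_real (exp (- s\<^sup>2 / 2)) = char std_normal_distribution s"
    by (simp add: char_std_normal_distribution)
  also have "\<dots> = (\<integral>t. std_normal_density t *\<^sub>R cis (s * t) \<partial>lborel)"
    unfolding char_def cis_conv_exp[symmetric]
    by (subst integral_density) auto
  finally show "(\<integral>t. complex_of_real (exp (- t\<^sup>2 / 2)) * cis (s * t) \<partial>lborel) = sqrt (2 * pi) * exp (- s\<^sup>2 / 2)"
    unfolding eq by (simp add: scaleR_conv_of_real mult.assoc)
qed

lemma integrable_gaussian: "integrable lborel (gaussian :: 'a::euclidean_space \<Rightarrow> real)"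
  using integrable_lborel_prod[OF integrable_gaussian_real, where 'a='a]
  unfolding gaussian_eq_prod[symmetric] .

lemma cis_sum: "finite A \<Longrightarrow> cis (\<Sum>b\<in>A. f b) = (\<Prod>b\<in>A. cis (f b))"
  by (induction A rule: finite_induct) (auto simp: cis_mult[symmetric])

lemma integral_gaussian_cis:
  "(\<integral>x. complex_of_real (gaussian x) * cis (u \<bullet> x) \<partial>lborel)
     = sqrt (2 * pi) ^ DIM('a) * gaussian (u :: 'a::euclidean_space)"
proof -
  have "complex_of_real (gaussian x) * cis (u \<bullet> x) =
      (\<Prod>b\<in>Basis. complex_of_real (exp (- (x \<bullet> b)\<^sup>2 / 2)) * cis ((u \<bullet> b) * (x \<bullet> b)))" for x
    unfolding gaussian_eq_prod prod.distrib by (subst euclidean_inner) (simp add: cis_sum)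
  then have "(\<integral>x. complex_of_real (gaussian x) * cis (u \<bullet> x) \<partial>lborel) =
      (\<integral>x. (\<Prod>b\<in>Basis. complex_of_real (exp (- (x \<bullet> b)\<^sup>2 / 2)) * cis ((u \<bullet> b) * (x \<bullet> b))) \<partial>lborel)"
    by simp
  also have "\<dots> = (\<Prod>b\<in>Basis. \<integral>t. complex_of_real (exp (- t\<^sup>2 / 2)) * cis ((u \<bullet> b) * t) \<partial>lborel)"
  proof (rule integral_lborel_prod)
    fix b :: 'a
    show "integrable lborel (\<lambda>t. complex_of_real (exp (- t\<^sup>2 / 2)) * cis ((u \<bullet> b) * t))"
      by (rule Bochner_Integration.integrable_bound[OF integrable_gaussian_real])
         (auto simp: norm_mult)
  qed
  also have "\<dots> = sqrt (2 * pi) ^ DIM('a) * gaussian u"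
    unfolding integral_gaussian_cis_real gaussian_eq_prod by (simp add: prod.distrib)
  finally show ?thesis .
qed

lemma integral_gaussian: "(\<integral>x. gaussian (x :: 'a::euclidean_space) \<partial>lborel) = sqrt (2 * pi) ^ DIM('a)"
proof -
  have "complex_of_real (\<integral>x. gaussian (x :: 'a) \<partial>lborel) = complex_of_real (sqrt (2 * pi) ^ DIM('a))"
    using integral_gaussian_cis[of "0::'a"] by (simp add: gaussian_def)
  then show ?thesis using of_real_eq_iff by blast
qed

lemma
  fixes f :: "'a::euclidean_space \<Rightarrow> 'b::{banach, second_countable_topology}"
  assumes "c \<noteq> 0" and [measurable]: "f \<in> borel_measurable borel"
  shows integral_lborel_affine:
      "(\<integral>x. f x \<partial>lborel) = \<bar>c\<bar> ^ DIM('a) *\<^sub>R (\<integral>x. f (t + c *\<^sub>R x) \<partial>lborel)"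
    and integrable_lborel_affine:
      "integrable lborel (\<lambda>x. f (t + c *\<^sub>R x)) \<longleftrightarrow> integrable lborel f"
proof -
  have m [measurable]: "(\<lambda>x. t + c *\<^sub>R x) \<in> borel_measurable borel" by simp
  show "(\<integral>x. f x \<partial>lborel) = \<bar>c\<bar> ^ DIM('a) *\<^sub>R (\<integral>x. f (t + c *\<^sub>R x) \<partial>lborel)"
    by (subst lborel_affine[OF assms(1), of t]) (simp add: integral_density integral_distr)
  show "integrable lborel (\<lambda>x. f (t + c *\<^sub>R x)) \<longleftrightarrow> integrable lborel f"
    using assms(1) integrable_scaleR_right[of "inverse (\<bar>c\<bar> ^ DIM('a))" lborel "\<lambda>x. \<bar>c\<bar> ^ DIM('a) *\<^sub>R f (t + c *\<^sub>R x)"]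
    by (subst (2) lborel_affine[OF assms(1), of t])
       (auto simp add: integrable_density integrable_distr_eq intro: integrable_scaleR_right)
qed

section \<open>Fourier inversion\<close>

lemma integrable_pair_bound:
  fixes F :: "'a::euclidean_space \<times> 'b::euclidean_space \<Rightarrow> complex"
  assumes [measurable]: "F \<in> borel_measurable borel"
    and f: "integrable lborel (f :: 'a \<Rightarrow> real)" and g: "integrable lborel (g :: 'b \<Rightarrow> real)"
    and le: "\<And>x y. cmod (F (x, y)) \<le> f x * g y"
  shows "integrable (lborel \<Otimes>\<^sub>M lborel) F"
proof (rule Bochner_Integration.integrable_bound)
  have [measurable]: "f \<in> borel_measurable borel" "g \<in> borel_measurable borel"
    using f g by (auto dest: borel_measurable_integrable)
  show "integrable (lborel \<Otimes>\<^sub>M lborel) (\<lambda>(x, y). f x * g y)"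
  proof (rule lborel_pair.Fubini_integrable)
    show "(\<lambda>(x, y). f x * g y) \<in> borel_measurable (lborel \<Otimes>\<^sub>M lborel)" by measurable
    show "integrable lborel (\<lambda>x. \<integral>y. norm (case (x, y) of (x, y) \<Rightarrow> f x * g y) \<partial>lborel)"
      using f by (simp add: abs_mult)
    show "AE x in lborel. integrable lborel (\<lambda>y. case (x, y) of (x, y) \<Rightarrow> f x * g y)"
      using g by simp
  qed
  show "F \<in> borel_measurable (lborel \<Otimes>\<^sub>M lborel)"
    by (simp add: lborel_prod)
  show "AE z in lborel \<Otimes>\<^sub>M lborel. norm (F z) \<le> norm (case z of (x, y) \<Rightarrow> f x * g y)"
    using le by (auto intro!: AE_I2 intro: order_trans[OF _ abs_ge_self])
qed

lemma Fubini_lborel_bound: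
  fixes F :: "'a::euclidean_space \<Rightarrow> 'b::euclidean_space \<Rightarrow> complex"
  assumes "(\<lambda>(x, y). F x y) \<in> borel_measurable borel"
    and "integrable lborel (f :: 'a \<Rightarrow> real)" and "integrable lborel (g :: 'b \<Rightarrow> real)"
    and "\<And>x y. cmod (F x y) \<le> f x * g y"
  shows "(\<integral>y. (\<integral>x. F x y \<partial>lborel) \<partial>lborel) = (\<integral>x. (\<integral>y. F x y \<partial>lborel) \<partial>lborel)"
  using lborel_pair.Fubini_integral[OF integrable_pair_bound[of "\<lambda>(x, y). F x y" f g]] assms by auto

text \<open>The Borel sets over which \<open>h\<close> integrates to \<open>0\<close> form a Dynkin system, and the boxes form an
  intersection-stable generator. The whole space belongs to the system as an increasing limit of boxes.\<close>
lemma AE_eq_0_if_box_integrals_0: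
  fixes h :: "'a::euclidean_space \<Rightarrow> 'b::{banach, second_countable_topology}"
  assumes h: "integrable lborel h"
    and box: "\<And>a b. (\<integral>x. indicator (box a b) x *\<^sub>R h x \<partial>lborel) = 0"
  shows "AE x in lborel. h x = 0"
proof (rule sigma_finite_measure.density_zero[OF sigma_finite_lborel h])
  have ih: "integrable lborel (\<lambda>x. indicator A x *\<^sub>R h x)" if "A \<in> sets borel" for A
    using integrable_mult_indicator[of A lborel h] h that by simp
  define I where "I A = (\<integral>x. indicator A x *\<^sub>R h x \<partial>lborel)" for A
  let ?G = "range (\<lambda>(a, b). box a b :: 'a set)"
  have sets: "sets borel = sigma_sets UNIV ?G"
    by (simp add: borel_eq_box)
  have UN: "I (\<Union>i. A i) = 0" if A: "\<And>i. A i \<in> sets borel" and disj: "disjoint_family A" and 0: "\<And>i. I (A i) = 0" for A :: "nat \<Rightarrow> 'a set"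
  proof -
    have "set_lebesgue_integral lborel (\<Union>i. A i) h = (\<Sum>i. set_lebesgue_integral lborel (A i) h)"
      by (rule lebesgue_integral_countable_add)
         (use A disj ih[of "\<Union>i. A i"] in \<open>auto simp: set_integrable_def disjoint_family_on_def\<close>)
    then show ?thesis using 0 by (simp add: I_def set_lebesgue_integral_def)
  qed
  have univ: "I UNIV = 0"
  proof -
    let ?A = "\<lambda>n::nat. box (- (real n *\<^sub>R One)) (real n *\<^sub>R One) :: 'a set"
    have "(\<lambda>n. I (?A n)) \<longlonglongrightarrow> I UNIV"
      unfolding I_def
    proof (rule integral_dominated_convergence[where w="\<lambda>x. norm (h x)"])
      show "AE x in lborel. (\<lambda>n. indicator (?A n) x *\<^sub>R h x) \<longlonglongrightarrow> indicator UNIV x *\<^sub>R h x"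
      proof (intro AE_I2 tendsto_eventually)
        fix x :: 'a
        obtain n where "x \<in> ?A n" using UN_box_eq_UNIV by blast
        moreover have "?A n \<subseteq> ?A m" if "n \<le> m" for m
          using that by (auto simp: subset_box)
        ultimately show "\<forall>\<^sub>F n in sequentially. indicator (?A n) x *\<^sub>R h x = indicator UNIV x *\<^sub>R h x"
          by (intro eventually_sequentiallyI[of n]) (auto simp: indicator_def)
      qed
    qed (use h ih in \<open>auto simp: indicator_def dest: borel_measurable_integrable\<close>)
    moreover have "I (?A n) = 0" for n unfolding I_def by (rule box)
    ultimately show ?thesis by (simp add: LIMSEQ_const_iff)
  qed
  have stable: "Int_stable ?G" by (auto simp: Int_stable_def box_Int_box)
  have sub: "?G \<subseteq> Pow UNIV" by simp
  fix A :: "'a set" assume "A \<in> sets lborel"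
  then have "A \<in> sigma_sets UNIV ?G" using sets by simp
  with stable sub have "I A = 0"
  proof (induction rule: sigma_sets_induct_disjoint)
    case (basic A) then show ?case using box by (auto simp: I_def)
  next
    case empty show ?case by (simp add: I_def)
  next
    case (compl A)
    then have A: "A \<in> sets borel" using sets by blast
    have "I (UNIV - A) = (\<integral>x. indicator UNIV x *\<^sub>R h x - indicator A x *\<^sub>R h x \<partial>lborel)"
      unfolding I_def by (intro Bochner_Integration.integral_cong) (auto simp: indicator_def)
    also have "\<dots> = I UNIV - I A"
      unfolding I_def using ih[OF A] ih[of UNIV] by (intro Bochner_Integration.integral_diff) auto
    finally show ?case using compl univ by simp
  next
    case (union A)
    then show ?case using sets by (intro UN) blast+
  qed
  then show "set_lebesgue_integral lborel A h = 0"
    by (simp add: I_def set_lebesgue_integral_def)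
qed

definition inverse_fourier :: "('a::euclidean_space \<Rightarrow> complex) \<Rightarrow> 'a \<Rightarrow> complex" where
  "inverse_fourier g x = (LINT \<xi>|lborel. g \<xi> * cis (2 * pi * (x \<bullet> \<xi>)))"

lemma fourier_cis: "fourier f \<xi> = (LINT x|lborel. f x * cis (- (2 * pi * (x \<bullet> \<xi>))))"
  unfolding fourier_def cis_conv_exp by (simp add: mult_ac)

text \<open>As \<open>\<epsilon>\<close> tends to \<open>0\<close>, the transform of the flattened Gaussian concentrates at the origin: it is the
  approximate identity by which inversion is proved.\<close>
lemma integral_scaled_gaussian_cis:
  fixes u :: "'a::euclidean_space"
  assumes "\<epsilon> > 0"
  shows "(\<integral>\<xi>. complex_of_real (gaussian (\<epsilon> *\<^sub>R \<xi>)) * cis (2 * pi * (u \<bullet> \<xi>)) \<partial>lborel)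
     = (1 / \<epsilon>) ^ DIM('a) * sqrt (2 * pi) ^ DIM('a) * gaussian ((2 * pi / \<epsilon>) *\<^sub>R u)"
proof -
  have "(\<integral>\<xi>. complex_of_real (gaussian (\<epsilon> *\<^sub>R \<xi>)) * cis (2 * pi * (u \<bullet> \<xi>)) \<partial>lborel)
     = \<bar>1/\<epsilon>\<bar> ^ DIM('a) *\<^sub>R (\<integral>\<xi>. complex_of_real (gaussian (\<epsilon> *\<^sub>R (0 + (1/\<epsilon>) *\<^sub>R \<xi>))) * cis (2 * pi * (u \<bullet> (0 + (1/\<epsilon>) *\<^sub>R \<xi>))) \<partial>lborel)"
    by (rule integral_lborel_affine) (use assms in \<open>auto intro!: borel_measurable_times\<close>)
  also have "\<dots> = \<bar>1/\<epsilon>\<bar> ^ DIM('a) *\<^sub>R (\<integral>\<xi>. complex_of_real (gaussian \<xi>) * cis (((2 * pi / \<epsilon>) *\<^sub>R u) \<bullet> \<xi>) \<partial>lborel)"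
    using assms by (simp add: field_simps)
  finally show ?thesis
    using assms unfolding integral_gaussian_cis by (simp add: scaleR_conv_of_real)
qed

text \<open>The approximate identity has mass \<open>1\<close> because the factor \<open>sqrt (2 * pi) ^ DIM('a)\<close> and the equal
  mass of the Gaussian together cancel the Jacobian of the dilation by \<open>2 * pi\<close>.\<close>
lemma
  shows integrable_approx_kernel: "integrable lborel (\<lambda>t::'a::euclidean_space. gaussian ((2 * pi) *\<^sub>R t))"
    and integral_approx_kernel:
      "(\<integral>t. sqrt (2 * pi) ^ DIM('a) * gaussian ((2 * pi) *\<^sub>R (t :: 'a)) \<partial>lborel) = 1"
proof -
  have "integrable lborel (\<lambda>t::'a. gaussian (0 + (2 * pi) *\<^sub>R t))"
    by (subst integrable_lborel_affine) (auto simp: integrable_gaussian)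
  then show i: "integrable lborel (\<lambda>t::'a. gaussian ((2 * pi) *\<^sub>R t))" by simp
  have "sqrt (2 * pi) ^ DIM('a) = (2 * pi) ^ DIM('a) * (\<integral>t. gaussian ((2 * pi) *\<^sub>R (t :: 'a)) \<partial>lborel)"
    using integral_lborel_affine[of "2 * pi" "gaussian :: 'a \<Rightarrow> real" 0] by (simp add: integral_gaussian)
  moreover have "sqrt (2 * pi) ^ DIM('a) * sqrt (2 * pi) ^ DIM('a) = (2 * pi) ^ DIM('a)"
    by (subst power_mult_distrib[symmetric]) simp
  ultimately have "(2 * pi) ^ DIM('a) * (sqrt (2 * pi) ^ DIM('a) * (\<integral>t. gaussian ((2 * pi) *\<^sub>R (t :: 'a)) \<partial>lborel)) = (2 * pi) ^ DIM('a)"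
    by (simp add: mult_ac)
  then show "(\<integral>t. sqrt (2 * pi) ^ DIM('a) * gaussian ((2 * pi) *\<^sub>R (t :: 'a)) \<partial>lborel) = 1"
    using i by simp
qed

text \<open>The Gaussian factor makes the double integral absolutely convergent, so that Fubini's theorem
  turns a regularised inversion integral into a convolution of \<open>\<psi>\<close> with the approximate identity.\<close>
lemma gaussian_mean_fourier:
  fixes \<psi> :: "'a::euclidean_space \<Rightarrow> complex"
  assumes \<psi>: "integrable lborel \<psi>" and "\<epsilon> > 0"
  shows "(\<integral>\<xi>. fourier \<psi> \<xi> * gaussian (\<epsilon> *\<^sub>R \<xi>) * cis (2 * pi * (x \<bullet> \<xi>)) \<partial>lborel)
    = (\<integral>y. \<psi> y * ((1 / \<epsilon>) ^ DIM('a) * sqrt (2 * pi) ^ DIM('a) * gaussian ((2 * pi / \<epsilon>) *\<^sub>R (x - y))) \<partial>lborel)"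
proof -
  have [measurable]: "\<psi> \<in> borel_measurable borel"
    using \<psi> by (auto dest: borel_measurable_integrable)
  have "integrable lborel (\<lambda>\<xi>::'a. gaussian (0 + \<epsilon> *\<^sub>R \<xi>))"
    using assms by (subst integrable_lborel_affine) (auto simp: integrable_gaussian)
  then have g: "integrable lborel (\<lambda>\<xi>::'a. gaussian (\<epsilon> *\<^sub>R \<xi>))" by simp
  let ?F = "\<lambda>y \<xi>. \<psi> y * gaussian (\<epsilon> *\<^sub>R \<xi>) * cis (2 * pi * ((x - y) \<bullet> \<xi>))"
  have "(\<integral>\<xi>. fourier \<psi> \<xi> * gaussian (\<epsilon> *\<^sub>R \<xi>) * cis (2 * pi * (x \<bullet> \<xi>)) \<partial>lborel)
     = (\<integral>\<xi>. (\<integral>y. ?F y \<xi> \<partial>lborel) \<partial>lborel)"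
  proof (intro Bochner_Integration.integral_cong refl)
    fix \<xi> :: 'a
    have "fourier \<psi> \<xi> * gaussian (\<epsilon> *\<^sub>R \<xi>) * cis (2 * pi * (x \<bullet> \<xi>)) =
       (\<integral>y. \<psi> y * cis (- (2 * pi * (y \<bullet> \<xi>))) * (gaussian (\<epsilon> *\<^sub>R \<xi>) * cis (2 * pi * (x \<bullet> \<xi>))) \<partial>lborel)"
      unfolding fourier_cis mult.assoc[of "integral\<^sup>L _ _"] by (rule integral_mult_left_zero[symmetric])
    also have "\<dots> = (\<integral>y. ?F y \<xi> \<partial>lborel)"
    proof (intro Bochner_Integration.integral_cong refl)
      fix y
      have "cis (- (2 * pi * (y \<bullet> \<xi>))) * cis (2 * pi * (x \<bullet> \<xi>)) = cis (2 * pi * ((x - y) \<bullet> \<xi>))"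
        unfolding cis_mult by (simp add: inner_diff_left algebra_simps)
      then show "\<psi> y * cis (- (2 * pi * (y \<bullet> \<xi>))) * (gaussian (\<epsilon> *\<^sub>R \<xi>) * cis (2 * pi * (x \<bullet> \<xi>))) = ?F y \<xi>"
        by (simp add: mult_ac)
    qed
    finally show "fourier \<psi> \<xi> * gaussian (\<epsilon> *\<^sub>R \<xi>) * cis (2 * pi * (x \<bullet> \<xi>)) = (\<integral>y. ?F y \<xi> \<partial>lborel)" .
  qed
  also have "\<dots> = (\<integral>y. (\<integral>\<xi>. ?F y \<xi> \<partial>lborel) \<partial>lborel)"
  proof (rule Fubini_lborel_bound[OF _ integrable_norm[OF \<psi>] g])
    show "(\<lambda>(y, \<xi>). ?F y \<xi>) \<in> borel_measurable borel"
      unfolding borel_prod[symmetric] by measurable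
    show "cmod (?F y \<xi>) \<le> norm (\<psi> y) * gaussian (\<epsilon> *\<^sub>R \<xi>)" for y \<xi>
      by (simp add: norm_mult less_imp_le[OF gaussian_bounds(1)])
  qed
  also have "\<dots> = (\<integral>y. \<psi> y * ((1 / \<epsilon>) ^ DIM('a) * sqrt (2 * pi) ^ DIM('a) * gaussian ((2 * pi / \<epsilon>) *\<^sub>R (x - y))) \<partial>lborel)"
    unfolding mult.assoc[of "\<psi> _"] integral_mult_right_zero integral_scaled_gaussian_cis[OF assms(2)]
    by simp
  finally show ?thesis .
qed

lemma integral_approx_kernel_translate:
  fixes y :: "'a::euclidean_space"
  assumes "\<epsilon> > 0" and [measurable]: "g \<in> borel_measurable borel"
  shows "(\<integral>x. (1 / \<epsilon>) ^ DIM('a) * sqrt (2 * pi) ^ DIM('a) * gaussian ((2 * pi / \<epsilon>) *\<^sub>R (x - y)) * g x \<partial>lborel)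
    = (\<integral>t. sqrt (2 * pi) ^ DIM('a) * gaussian ((2 * pi) *\<^sub>R t) * g (y + \<epsilon> *\<^sub>R t) \<partial>lborel)"
  using assms(1)
  by (subst integral_lborel_affine[of \<epsilon> _ y]) (auto simp: field_simps simp flip: integral_mult_right_zero)

text \<open>Integrate the regularised inversion integral over a box and let the regularisation tend to \<open>0\<close>.
  On the Fourier side it converges pointwise and boundedly to the inverse transform. On the other
  side the approximate identity can be moved from \<open>\<psi>\<close> to the indicator of the box, where it converges off
  the boundary, that is, almost everywhere. Boxes suffice as test functions because their integrals
  determine an integrable function.\<close>
lemma box_integral_inverse_fourier:
  fixes \<psi> :: "'a::euclidean_space \<Rightarrow> complex" and a b :: 'a
  assumes \<psi>: "integrable lborel \<psi>" and \<phi>: "integrable lborel (fourier \<psi>)"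
  shows "(\<integral>x. indicator (box a b) x *\<^sub>R \<psi> x \<partial>lborel)
       = (\<integral>x. indicator (box a b) x *\<^sub>R inverse_fourier (fourier \<psi>) x \<partial>lborel)"
proof -
  have [measurable]: "\<psi> \<in> borel_measurable borel" "fourier \<psi> \<in> borel_measurable borel"
    using \<psi> \<phi> by (auto dest: borel_measurable_integrable)
  define g :: "'a \<Rightarrow> real" where "g = indicator (box a b)"
  have g [measurable]: "g \<in> borel_measurable borel" unfolding g_def by measurable
  have ig: "integrable lborel g"
    unfolding g_def by (intro integrable_real_indicator) (auto simp: emeasure_lborel_box_eq)
  have g01: "0 \<le> g x" "g x \<le> 1" for x by (auto simp: g_def indicator_def)
  define e :: "nat \<Rightarrow> real" where "e k = 1 / real (Suc k)" for k
  have e0: "e k > 0" for k by (simp add: e_def)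
  have elim: "e \<longlonglongrightarrow> 0" unfolding e_def by (rule LIMSEQ_Suc[OF lim_1_over_n])
  \<comment> \<open>\<open>T k\<close> is the regularised inversion integral and \<open>M k\<close> is the smoothed indicator of the box.\<close>
  define T where "T k x = (\<integral>\<xi>. fourier \<psi> \<xi> * gaussian (e k *\<^sub>R \<xi>) * cis (2 * pi * (x \<bullet> \<xi>)) \<partial>lborel)" for k x
  define Z where "Z = sqrt (2 * pi) ^ DIM('a)"
  have Z0: "Z > 0" by (simp add: Z_def)
  define M where "M k y = (\<integral>t. Z * gaussian ((2 * pi) *\<^sub>R t) * g (y + e k *\<^sub>R t) \<partial>lborel)" for k y
  have iker: "integrable lborel (\<lambda>t::'a. Z * gaussian ((2 * pi) *\<^sub>R t))"
    using integrable_approx_kernel[where 'a='a] by simp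
  have kg: "norm (Z * gaussian ((2 * pi) *\<^sub>R t) * g x) \<le> Z * gaussian ((2 * pi) *\<^sub>R t)" for t x :: 'a
  proof -
    have n: "0 \<le> Z * gaussian ((2 * pi) *\<^sub>R t)"
      using Z0 gaussian_bounds(1)[of "(2 * pi) *\<^sub>R t"] by simp
    then have "norm (Z * gaussian ((2 * pi) *\<^sub>R t) * g x) = Z * gaussian ((2 * pi) *\<^sub>R t) * g x"
      using g01(1)[of x] by (simp only: real_norm_def abs_of_nonneg mult_nonneg_nonneg)
    also have "\<dots> \<le> Z * gaussian ((2 * pi) *\<^sub>R t)"
      by (rule mult_left_le[OF g01(2) n])
    finally show ?thesis .
  qed
  have Tm [measurable]: "T k \<in> borel_measurable borel" for k
    unfolding T_def by (rule lborel.borel_measurable_lebesgue_integral) measurable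
  have Mm [measurable]: "M k \<in> borel_measurable borel" for k
    unfolding M_def by (rule lborel.borel_measurable_lebesgue_integral) measurable

  have eq: "(\<integral>x. g x *\<^sub>R T k x \<partial>lborel) = (\<integral>y. M k y *\<^sub>R \<psi> y \<partial>lborel)" for k
  proof -
    define K where "K u = (1 / e k) ^ DIM('a) * Z * gaussian ((2 * pi / e k) *\<^sub>R u)" for u :: 'a
    let ?F = "\<lambda>y x. g x *\<^sub>R (\<psi> y * complex_of_real (K (x - y)))"
    have [measurable]: "K \<in> borel_measurable borel" unfolding K_def by measurable
    have K: "0 \<le> K u" "K u \<le> (1 / e k) ^ DIM('a) * Z" for u
      using e0[of k] Z0 gaussian_bounds[of "(2 * pi / e k) *\<^sub>R u"] unfolding K_def
      by (auto intro!: mult_nonneg_nonneg mult_left_le)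
    have "(\<integral>x. g x *\<^sub>R T k x \<partial>lborel) = (\<integral>x. (\<integral>y. ?F y x \<partial>lborel) \<partial>lborel)"
      unfolding T_def gaussian_mean_fourier[OF \<psi> e0] K_def Z_def by simp
    also have "\<dots> = (\<integral>y. (\<integral>x. ?F y x \<partial>lborel) \<partial>lborel)"
    proof (rule Fubini_lborel_bound[of _ "\<lambda>y. norm (\<psi> y)" "\<lambda>x. (1 / e k) ^ DIM('a) * Z * g x"])
      show "(\<lambda>(y, x). ?F y x) \<in> borel_measurable borel"
        unfolding borel_prod[symmetric] by measurable
      show "cmod (?F y x) \<le> norm (\<psi> y) * ((1 / e k) ^ DIM('a) * Z * g x)" for x y
      proof -
        have "cmod (?F y x) = norm (\<psi> y) * (K (x - y) * g x)"
          using K(1)[of "x - y"] g01[of x] by (simp add: norm_mult abs_mult mult_ac)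
        also have "\<dots> \<le> norm (\<psi> y) * ((1 / e k) ^ DIM('a) * Z * g x)"
          using K(2)[of "x - y"] g01[of x] by (intro mult_left_mono mult_right_mono) auto
        finally show ?thesis .
      qed
      show "integrable lborel (\<lambda>y. norm (\<psi> y))" using \<psi> by (rule integrable_norm)
      show "integrable lborel (\<lambda>x. (1 / e k) ^ DIM('a) * Z * g x)" using ig by (rule integrable_mult_right)
    qed
    also have "\<dots> = (\<integral>y. M k y *\<^sub>R \<psi> y \<partial>lborel)"
    proof (intro Bochner_Integration.integral_cong refl)
      fix y
      have "(\<integral>x. ?F y x \<partial>lborel) = (\<integral>x. complex_of_real (K (x - y) * g x) * \<psi> y \<partial>lborel)"
        by (simp add: scaleR_conv_of_real mult_ac)
      also have "\<dots> = complex_of_real (\<integral>x. K (x - y) * g x \<partial>lborel) * \<psi> y"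
        by (simp only: integral_mult_left_zero integral_complex_of_real)
      also have "(\<integral>x. K (x - y) * g x \<partial>lborel) = M k y"
        unfolding M_def K_def Z_def by (rule integral_approx_kernel_translate[OF e0 g])
      finally show "(\<integral>x. ?F y x \<partial>lborel) = M k y *\<^sub>R \<psi> y" by (simp add: scaleR_conv_of_real)
    qed
    finally show ?thesis .
  qed

  have Mlim: "(\<lambda>k. M k y) \<longlonglongrightarrow> g y" if y: "y \<notin> cbox a b - box a b" for y
  proof -
    have "(\<lambda>k. M k y) \<longlonglongrightarrow> (\<integral>t. Z * gaussian ((2 * pi) *\<^sub>R (t::'a)) * g y \<partial>lborel)"
      unfolding M_def
    proof (rule integral_dominated_convergence[where w="\<lambda>t. Z * gaussian ((2 * pi) *\<^sub>R t)"])
      show "AE t in lborel. (\<lambda>k. Z * gaussian ((2 * pi) *\<^sub>R t) * g (y + e k *\<^sub>R t)) \<longlonglongrightarrow> Z * gaussian ((2 * pi) *\<^sub>R t) * g y"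
      proof (intro AE_I2 tendsto_mult tendsto_const tendsto_eventually)
        fix t :: 'a
        have lim: "(\<lambda>k. y + e k *\<^sub>R t) \<longlonglongrightarrow> y"
          using tendsto_add[OF tendsto_const[of y] tendsto_scaleR[OF elim tendsto_const[of t]]] by simp
        consider "y \<in> box a b" | "y \<in> - cbox a b" using y by auto
        then show "\<forall>\<^sub>F k in sequentially. g (y + e k *\<^sub>R t) = g y"
        proof cases
          case 1
          show ?thesis
            using topological_tendstoD[OF lim open_box 1] by eventually_elim (use 1 in \<open>simp add: g_def\<close>)
        next
          case 2
          have "\<forall>\<^sub>F k in sequentially. y + e k *\<^sub>R t \<in> - cbox a b"
            by (rule topological_tendstoD[OF lim _ 2]) auto
          then show ?thesis
            by eventually_elim (use 2 box_subset_cbox[of a b] in \<open>auto simp: g_def indicator_def\<close>)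
        qed
      qed
      show "AE t in lborel. norm (Z * gaussian ((2 * pi) *\<^sub>R t) * g (y + e k *\<^sub>R t)) \<le> Z * gaussian ((2 * pi) *\<^sub>R t)" for k
        using kg by simp
      show "integrable lborel (\<lambda>t::'a. Z * gaussian ((2 * pi) *\<^sub>R t))" by (rule iker)
    qed measurable
    also have "(\<integral>t. Z * gaussian ((2 * pi) *\<^sub>R (t::'a)) * g y \<partial>lborel) = g y"
      using integral_approx_kernel[where 'a='a] by (simp add: Z_def)
    finally show ?thesis .
  qed
  have M1: "\<bar>M k y\<bar> \<le> 1" for k y
  proof -
    have "\<bar>M k y\<bar> \<le> (\<integral>t. Z * gaussian ((2 * pi) *\<^sub>R (t::'a)) \<partial>lborel)"
      unfolding M_def real_norm_def[symmetric]
    proof (rule Bochner_Integration.integral_norm_bound_integral)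
      show le: "norm (Z * gaussian ((2 * pi) *\<^sub>R t) * g (y + e k *\<^sub>R t)) \<le> Z * gaussian ((2 * pi) *\<^sub>R t)" for t
        by (rule kg)
      show "integrable lborel (\<lambda>t. Z * gaussian ((2 * pi) *\<^sub>R t) * g (y + e k *\<^sub>R t))"
        by (rule Bochner_Integration.integrable_bound[OF iker]) (measurable, use order_trans[OF le abs_ge_self] in \<open>simp only: real_norm_def AE_I2\<close>)
    qed (rule iker)
    then show ?thesis using integral_approx_kernel[where 'a='a] by (simp add: Z_def)
  qed

  have null: "cbox a b - box a b \<in> null_sets lborel"
    using negligible_frontier_interval[of a b]
    by (simp add: negligible_iff_null_sets null_sets_completion_iff)
  have R: "(\<lambda>k. \<integral>y. M k y *\<^sub>R \<psi> y \<partial>lborel) \<longlonglongrightarrow> (\<integral>y. g y *\<^sub>R \<psi> y \<partial>lborel)"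
  proof (rule integral_dominated_convergence[where w="\<lambda>y. norm (\<psi> y)"])
    show "AE y in lborel. (\<lambda>k. M k y *\<^sub>R \<psi> y) \<longlonglongrightarrow> g y *\<^sub>R \<psi> y"
      using AE_not_in[OF null] by eventually_elim (intro tendsto_intros Mlim)
    show "AE y in lborel. norm (M k y *\<^sub>R \<psi> y) \<le> norm (\<psi> y)" for k
      using M1 by (auto intro!: mult_left_le_one_le)
    show "integrable lborel (\<lambda>y. norm (\<psi> y))" using \<psi> by (rule integrable_norm)
  qed measurable

  have fg: "norm (fourier \<psi> \<xi> * gaussian (e k *\<^sub>R \<xi>) * cis (2 * pi * (x \<bullet> \<xi>))) \<le> norm (fourier \<psi> \<xi>)" for k x \<xi>
    using gaussian_bounds[of "e k *\<^sub>R \<xi>"] by (simp add: norm_mult mult_left_le less_imp_le abs_of_pos)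
  have Tlim: "(\<lambda>k. T k x) \<longlonglongrightarrow> inverse_fourier (fourier \<psi>) x" for x
    unfolding T_def inverse_fourier_def
  proof (rule integral_dominated_convergence[where w="\<lambda>y. norm (fourier \<psi> y)"])
    have "(\<lambda>k. gaussian (e k *\<^sub>R \<xi>)) \<longlonglongrightarrow> gaussian (0 *\<^sub>R \<xi>)" for \<xi> :: 'a
      unfolding gaussian_def by (intro tendsto_intros elim) auto
    then have g1: "(\<lambda>k. complex_of_real (gaussian (e k *\<^sub>R \<xi>))) \<longlonglongrightarrow> 1" for \<xi> :: 'a
      using tendsto_of_real[of "\<lambda>k. gaussian (e k *\<^sub>R \<xi>)" 1 sequentially] by (simp add: gaussian_def)
    show "AE \<xi> in lborel. (\<lambda>k. fourier \<psi> \<xi> * gaussian (e k *\<^sub>R \<xi>) * cis (2 * pi * (x \<bullet> \<xi>))) \<longlonglongrightarrow> fourier \<psi> \<xi> * cis (2 * pi * (x \<bullet> \<xi>))"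
    proof (rule AE_I2)
      fix \<xi> :: 'a
      show "(\<lambda>k. fourier \<psi> \<xi> * gaussian (e k *\<^sub>R \<xi>) * cis (2 * pi * (x \<bullet> \<xi>))) \<longlonglongrightarrow> fourier \<psi> \<xi> * cis (2 * pi * (x \<bullet> \<xi>))"
        using tendsto_mult[OF tendsto_mult[OF tendsto_const[of "fourier \<psi> \<xi>"] g1[of \<xi>]]
            tendsto_const[of "cis (2 * pi * (x \<bullet> \<xi>))"]]
        by (simp only: mult_1_right)
    qed
    show "AE \<xi> in lborel. norm (fourier \<psi> \<xi> * gaussian (e k *\<^sub>R \<xi>) * cis (2 * pi * (x \<bullet> \<xi>))) \<le> norm (fourier \<psi> \<xi>)" for k
      using fg by simp
    show "integrable lborel (\<lambda>y. norm (fourier \<psi> y))" using \<phi> by (rule integrable_norm)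
  qed measurable
  have T1: "norm (T k x) \<le> (\<integral>\<xi>. norm (fourier \<psi> \<xi>) \<partial>lborel)" for k x
    unfolding T_def
  proof (rule Bochner_Integration.integral_norm_bound_integral)
    show le: "norm (fourier \<psi> \<xi> * gaussian (e k *\<^sub>R \<xi>) * cis (2 * pi * (x \<bullet> \<xi>))) \<le> norm (fourier \<psi> \<xi>)" for \<xi>
      by (rule fg)
    show "integrable lborel (\<lambda>\<xi>. fourier \<psi> \<xi> * gaussian (e k *\<^sub>R \<xi>) * cis (2 * pi * (x \<bullet> \<xi>)))"
      by (rule Bochner_Integration.integrable_bound[OF \<phi>]) (measurable, use le in auto)
  qed (rule integrable_norm[OF \<phi>])
  have L: "(\<lambda>k. \<integral>x. g x *\<^sub>R T k x \<partial>lborel) \<longlonglongrightarrow> (\<integral>x. g x *\<^sub>R inverse_fourier (fourier \<psi>) x \<partial>lborel)"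
  proof (rule integral_dominated_convergence[where w="\<lambda>x. g x * (\<integral>\<xi>. norm (fourier \<psi> \<xi>) \<partial>lborel)"])
    show "AE x in lborel. (\<lambda>k. g x *\<^sub>R T k x) \<longlonglongrightarrow> g x *\<^sub>R inverse_fourier (fourier \<psi>) x"
      by (intro AE_I2 tendsto_intros Tlim)
    show "AE x in lborel. norm (g x *\<^sub>R T k x) \<le> g x * (\<integral>\<xi>. norm (fourier \<psi> \<xi>) \<partial>lborel)" for k
      using T1 g01 by (auto intro!: mult_left_mono)
    have "inverse_fourier (fourier \<psi>) \<in> borel_measurable borel"
      unfolding inverse_fourier_def by (rule lborel.borel_measurable_lebesgue_integral) measurable
    then show "(\<lambda>x. g x *\<^sub>R inverse_fourier (fourier \<psi>) x) \<in> borel_measurable lborel" by simp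
    show "integrable lborel (\<lambda>x. g x * (\<integral>\<xi>. norm (fourier \<psi> \<xi>) \<partial>lborel))"
      using ig by (rule integrable_mult_left)
  qed measurable
  show ?thesis
    using LIMSEQ_unique[OF L[unfolded eq] R] by (simp add: g_def)
qed

text \<open>Both sides are integrable, and an integrable function is determined by its integrals over boxes.\<close>
lemma AE_eq_inverse_fourier:
  fixes \<psi> :: "'a::euclidean_space \<Rightarrow> complex"
  assumes "integrable lborel \<psi>" "integrable lborel (fourier \<psi>)"
    and "integrable lborel (inverse_fourier (fourier \<psi>))"
  shows "AE x in lborel. \<psi> x = inverse_fourier (fourier \<psi>) x"
proof -
  have "AE x in lborel. \<psi> x - inverse_fourier (fourier \<psi>) x = 0"
  proof (rule AE_eq_0_if_box_integrals_0)
    fix a b :: 'a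
    have i: "integrable lborel (\<lambda>x. indicator (box a b) x *\<^sub>R h x)" if "integrable lborel h" for h :: "'a \<Rightarrow> complex"
      using that by (intro integrable_mult_indicator) auto
    show "(\<integral>x. indicator (box a b) x *\<^sub>R (\<psi> x - inverse_fourier (fourier \<psi>) x) \<partial>lborel) = 0"
      unfolding scaleR_diff_right
      by (subst Bochner_Integration.integral_diff) (use assms i box_integral_inverse_fourier in auto)
  qed (use assms in auto)
  then show ?thesis by simp
qed

section \<open>Rapid decay of inverse Fourier transforms\<close>

text \<open>Closure under directional derivatives is what allows the decay estimate to be iterated. Off the
  support \<open>\<phi>\<close> is locally zero, so the derivative has no larger support.\<close>
lemma test_functions_directional_derivative:
  fixes \<phi> :: "'a::euclidean_space \<Rightarrow> complex"
  assumes "\<phi> \<in> test_functions UNIV"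
  shows "(\<lambda>\<xi>. frechet_derivative \<phi> (at \<xi>) u) \<in> test_functions UNIV"
proof -
  let ?D = "\<lambda>\<xi>. frechet_derivative \<phi> (at \<xi>) u" and ?S = "closure {\<xi>. \<phi> \<xi> \<noteq> 0}"
  have S: "compact ?S" and Ck: "C_k k \<phi>" for k
    using assms by (auto simp: test_functions_def)
  have "?D \<xi> = 0" if "\<xi> \<notin> ?S" for \<xi>
  proof -
    have "\<phi> differentiable (at \<xi>)" using Ck[of 1] by simp
    then have "frechet_derivative \<phi> (at \<xi>) = frechet_derivative (\<lambda>_. 0) (at \<xi>)"
      by (rule frechet_derivative_transform_within_open[where X="- ?S"])
         (use that closure_subset[of "{\<xi>. \<phi> \<xi> \<noteq> 0}"] in auto)
    then show ?thesis by simp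
  qed
  then have "{\<xi>. ?D \<xi> \<noteq> 0} \<subseteq> ?S" by blast
  then have "closure {\<xi>. ?D \<xi> \<noteq> 0} \<subseteq> ?S"
    by (simp add: closure_minimal)
  then have "compact (closure {\<xi>. ?D \<xi> \<noteq> 0})"
    using compact_Int_closed[OF S closed_closure, of "{\<xi>. ?D \<xi> \<noteq> 0}"] by (simp add: Int_absorb1)
  moreover have "C_k k ?D" for k
    using Ck[of "Suc k"] by simp
  ultimately show ?thesis by (simp add: test_functions_def)
qed

lemma
  fixes \<phi> :: "'a::euclidean_space \<Rightarrow> complex"
  assumes "\<phi> \<in> test_functions UNIV"
  shows test_functions_continuous: "continuous_on UNIV \<phi>"
    and test_functions_support: "\<exists>R>0. \<forall>\<xi>. \<phi> \<xi> \<noteq> 0 \<longrightarrow> norm \<xi> \<le> R"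
    and test_functions_bounded: "\<exists>B>0. \<forall>\<xi>. cmod (\<phi> \<xi>) \<le> B"
    and test_functions_integrable: "integrable lborel \<phi>"
proof -
  let ?S = "closure {\<xi>. \<phi> \<xi> \<noteq> 0}"
  have "C_k 0 \<phi>" and S: "compact ?S"
    using assms by (auto simp: test_functions_def)
  then show c: "continuous_on UNIV \<phi>" by simp
  have S0: "\<phi> \<xi> = 0" if "\<xi> \<notin> ?S" for \<xi>
    using that closure_subset[of "{\<xi>. \<phi> \<xi> \<noteq> 0}"] by auto
  obtain R where "R > 0" "\<forall>\<xi>\<in>?S. norm \<xi> \<le> R"
    using compact_imp_bounded[OF S] bounded_pos by blast
  then show "\<exists>R>0. \<forall>\<xi>. \<phi> \<xi> \<noteq> 0 \<longrightarrow> norm \<xi> \<le> R" using S0 by blast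
  have cS: "continuous_on ?S \<phi>" by (rule continuous_on_subset[OF c]) simp
  then have "bounded (\<phi> ` ?S)"
    using S by (intro compact_imp_bounded compact_continuous_image)
  then obtain B where "B > 0" "\<forall>z\<in>\<phi> ` ?S. cmod z \<le> B"
    using bounded_pos by blast
  moreover have "cmod (\<phi> \<xi>) \<le> B" for \<xi>
    using calculation S0[of \<xi>] by (cases "\<xi> \<in> ?S") auto
  ultimately show "\<exists>B>0. \<forall>\<xi>. cmod (\<phi> \<xi>) \<le> B" by blast
  have "integrable lborel (\<lambda>\<xi>. indicator ?S \<xi> *\<^sub>R \<phi> \<xi>)"
    by (rule borel_integrable_compact[OF S cS])
  moreover have "indicator ?S \<xi> *\<^sub>R \<phi> \<xi> = \<phi> \<xi>" for \<xi>
    using S0[of \<xi>] by (cases "\<xi> \<in> ?S") simp_all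
  ultimately show "integrable lborel \<phi>" by (simp only:)
qed

lemma has_vector_derivative_sequentially:
  assumes f: "(f has_vector_derivative v) (at 0)"
    and t: "t \<longlonglongrightarrow> 0" "\<And>k. t k \<noteq> (0::real)"
  shows "(\<lambda>k. (f (t k) - f 0) /\<^sub>R t k) \<longlonglongrightarrow> v"
proof -
  have "((\<lambda>h. norm (f (0 + h) - f 0 - h *\<^sub>R v) / norm h) \<longlongrightarrow> 0) (at 0)"
    using f unfolding has_vector_derivative_def has_derivative_at by blast
  moreover have "filterlim t (at 0) sequentially"
    using t by (simp add: filterlim_at)
  ultimately have "(\<lambda>k. norm (f (0 + t k) - f 0 - t k *\<^sub>R v) / norm (t k)) \<longlonglongrightarrow> 0"
    by (rule filterlim_compose)
  moreover have "norm (f (0 + t k) - f 0 - t k *\<^sub>R v) / norm (t k) = norm ((f (t k) - f 0) /\<^sub>R t k - v)" for k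
  proof -
    have "(f (t k) - f 0) /\<^sub>R t k - v = (1 / t k) *\<^sub>R (f (t k) - f 0 - t k *\<^sub>R v)"
      using t(2)[of k] by (simp add: scaleR_right_diff_distrib divide_inverse)
    then show ?thesis by simp
  qed
  ultimately show ?thesis
    by (simp add: tendsto_norm_zero_iff LIM_zero_iff)
qed

text \<open>Integration by parts without boundary terms. By translation invariance of the integral, the
  inverse transform of the difference quotient of \<open>\<phi>\<close> in direction \<open>u\<close> is that of \<open>\<phi>\<close> times a difference
  quotient of \<open>t \<mapsto> cis (- 2 * pi * (x \<bullet> u) * t)\<close>. Both sides converge as the step tends to \<open>0\<close>, the left one
  by dominated convergence.\<close>
lemma inverse_fourier_derivative:
  fixes \<phi> :: "'a::euclidean_space \<Rightarrow> complex"
  assumes \<phi>: "\<phi> \<in> test_functions UNIV"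
  shows "inverse_fourier (\<lambda>\<xi>. frechet_derivative \<phi> (at \<xi>) u) x
       = - (\<i> * (2 * pi * (x \<bullet> u))) * inverse_fourier \<phi> x"
proof -
  let ?D = "\<lambda>\<xi>. frechet_derivative \<phi> (at \<xi>) u"
  have [measurable]: "\<phi> \<in> borel_measurable borel"
    by (intro borel_measurable_continuous_onI test_functions_continuous \<phi>)
  have [measurable]: "?D \<in> borel_measurable borel"
    by (intro borel_measurable_continuous_onI test_functions_continuous test_functions_directional_derivative \<phi>)
  have "C_k 1 \<phi>" using \<phi> unfolding test_functions_def by blast
  then have diff: "(\<phi> has_derivative frechet_derivative \<phi> (at \<xi>)) (at \<xi>)" for \<xi>
    by (simp add: frechet_derivative_works)
  have line: "((\<lambda>t. \<phi> (\<xi> + t *\<^sub>R u)) has_vector_derivative ?D (\<xi> + t *\<^sub>R u)) (at t)" for \<xi> t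
  proof -
    have "((\<lambda>t. \<xi> + t *\<^sub>R u) has_derivative (\<lambda>t. t *\<^sub>R u)) (at t)"
      by (auto intro!: derivative_eq_intros)
    then have "((\<lambda>t. \<phi> (\<xi> + t *\<^sub>R u)) has_derivative (\<lambda>s. frechet_derivative \<phi> (at (\<xi> + t *\<^sub>R u)) (s *\<^sub>R u))) (at t)"
      by (rule has_derivative_compose) (rule diff)
    moreover have "frechet_derivative \<phi> (at (\<xi> + t *\<^sub>R u)) (s *\<^sub>R u) = s *\<^sub>R ?D (\<xi> + t *\<^sub>R u)" for s
      using has_derivative_linear[OF diff] by (simp add: linear_scale)
    ultimately show ?thesis by (simp add: has_vector_derivative_def)
  qed
  obtain R where R: "R > 0" "\<And>\<xi>. \<phi> \<xi> \<noteq> 0 \<Longrightarrow> norm \<xi> \<le> R"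
    using test_functions_support[OF \<phi>] by blast
  obtain B where B: "B > 0" "\<And>\<xi>. cmod (?D \<xi>) \<le> B"
    using test_functions_bounded[OF test_functions_directional_derivative[OF \<phi>]] by blast
  define e :: "nat \<Rightarrow> real" where "e k = 1 / real (Suc k)" for k
  have e0: "e k > 0" "e k \<le> 1" for k by (auto simp: e_def)
  have elim: "e \<longlonglongrightarrow> 0" unfolding e_def by (rule LIMSEQ_Suc[OF lim_1_over_n])
  define q where "q k \<xi> = (\<phi> (\<xi> + e k *\<^sub>R u) - \<phi> \<xi>) /\<^sub>R e k" for k \<xi>
  have q_lim: "(\<lambda>k. q k \<xi>) \<longlonglongrightarrow> ?D \<xi>" for \<xi>
    using has_vector_derivative_sequentially[OF line[of \<xi> 0] elim] e0 unfolding q_def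
    by (simp add: less_imp_neq[symmetric])
  \<comment> \<open>The mean value theorem bounds the quotient by \<open>B\<close>. It vanishes outside a ball that is larger than
     the support of \<open>\<phi>\<close> by the length of the longest step.\<close>
  have q_bound: "cmod (q k \<xi>) \<le> indicator (cball 0 (R + norm u)) \<xi> * B" for k \<xi>
  proof (cases "\<xi> \<in> cball 0 (R + norm u)")
    case True
    have "cmod (\<phi> (\<xi> + e k *\<^sub>R u) - \<phi> (\<xi> + 0 *\<^sub>R u)) \<le> B * norm (e k - 0)"
    proof (rule differentiable_bound[where S=UNIV and f="\<lambda>t. \<phi> (\<xi> + t *\<^sub>R u)"])
      show "((\<lambda>t. \<phi> (\<xi> + t *\<^sub>R u)) has_derivative (\<lambda>s. s *\<^sub>R ?D (\<xi> + t *\<^sub>R u))) (at t within UNIV)" for t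
        using line unfolding has_vector_derivative_def by simp
      show "onorm (\<lambda>s. s *\<^sub>R ?D (\<xi> + t *\<^sub>R u)) \<le> B" for t
        by (rule onorm_le) (use B in \<open>simp add: mult.commute[of B] mult_left_mono\<close>)
    qed auto
    then have "cmod (\<phi> (\<xi> + e k *\<^sub>R u) - \<phi> \<xi>) \<le> B * e k"
      using e0[of k] by simp
    moreover have "cmod (q k \<xi>) = cmod (\<phi> (\<xi> + e k *\<^sub>R u) - \<phi> \<xi>) / e k"
      using e0[of k] by (simp add: q_def divide_inverse mult.commute)
    ultimately show ?thesis
      using True e0[of k] by (simp add: pos_divide_le_eq)
  next
    case False
    then have "norm \<xi> > R + norm u" by simp
    then have "\<phi> \<xi> = 0" using R(2)[of \<xi>] norm_ge_zero[of u] by fastforce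
    moreover have "\<phi> (\<xi> + e k *\<^sub>R u) = 0"
    proof (rule ccontr)
      assume "\<phi> (\<xi> + e k *\<^sub>R u) \<noteq> 0"
      then have "norm (\<xi> + e k *\<^sub>R u) \<le> R" by (rule R(2))
      moreover have "norm (e k *\<^sub>R u) \<le> norm u"
        using e0[of k] by (simp add: mult_left_le_one_le)
      moreover have "norm \<xi> \<le> norm (\<xi> + e k *\<^sub>R u) + norm (e k *\<^sub>R u)"
        using norm_triangle_ineq4[of "\<xi> + e k *\<^sub>R u" "e k *\<^sub>R u"] by simp
      ultimately show False using \<open>norm \<xi> > R + norm u\<close> by simp
    qed
    ultimately show ?thesis using False by (simp add: q_def)
  qed
  let ?c = "\<lambda>\<xi>. cis (2 * pi * (x \<bullet> \<xi>))"
  have [measurable]: "q k \<in> borel_measurable borel" for k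
    unfolding q_def by measurable
  have L: "(\<lambda>k. \<integral>\<xi>. q k \<xi> * ?c \<xi> \<partial>lborel) \<longlonglongrightarrow> inverse_fourier ?D x"
    unfolding inverse_fourier_def
  proof (rule integral_dominated_convergence[where w="\<lambda>\<xi>. indicator (cball 0 (R + norm u)) \<xi> * B"])
    show "AE \<xi> in lborel. (\<lambda>k. q k \<xi> * ?c \<xi>) \<longlonglongrightarrow> ?D \<xi> * ?c \<xi>"
      by (intro AE_I2 tendsto_mult tendsto_const q_lim)
    show "AE \<xi> in lborel. norm (q k \<xi> * ?c \<xi>) \<le> indicator (cball 0 (R + norm u)) \<xi> * B" for k
      using q_bound by (simp add: norm_mult)
    show "integrable lborel (\<lambda>\<xi>. indicator (cball 0 (R + norm u)) \<xi> * B :: real)"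
      by (intro integrable_mult_left integrable_real_indicator) 
         (simp_all add: emeasure_compact_finite[OF compact_cball] flip: infinity_ennreal_def)
  qed measurable
  have trans: "(\<integral>\<xi>. \<phi> (\<xi> + t *\<^sub>R u) * ?c \<xi> \<partial>lborel) = cis (- (2 * pi * (x \<bullet> u)) * t) * inverse_fourier \<phi> x"
    and trans_int: "integrable lborel (\<lambda>\<xi>. \<phi> (\<xi> + t *\<^sub>R u) * ?c \<xi>)" for t
  proof -
    \<comment> \<open>The factor \<open>1\<close> fits the substitution rule \<open>integral_lborel_affine\<close>, used here for a pure translation.\<close>
    have c: "\<phi> (- (t *\<^sub>R u) + 1 *\<^sub>R \<xi> + t *\<^sub>R u) * ?c (- (t *\<^sub>R u) + 1 *\<^sub>R \<xi>) = cis (- (2 * pi * (x \<bullet> u)) * t) * (\<phi> \<xi> * ?c \<xi>)" for \<xi>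
    proof -
      have "?c (- (t *\<^sub>R u) + 1 *\<^sub>R \<xi>) = cis (- (2 * pi * (x \<bullet> u)) * t) * ?c \<xi>"
        unfolding cis_mult by (simp add: inner_diff_right algebra_simps)
      then show ?thesis by simp
    qed
    have int: "integrable lborel (\<lambda>\<xi>. \<phi> \<xi> * ?c \<xi>)"
      by (rule Bochner_Integration.integrable_bound[OF test_functions_integrable[OF \<phi>]])
         (auto simp: norm_mult)
    have m: "(\<lambda>\<xi>. \<phi> (\<xi> + t *\<^sub>R u) * ?c \<xi>) \<in> borel_measurable borel" by measurable
    show "(\<integral>\<xi>. \<phi> (\<xi> + t *\<^sub>R u) * ?c \<xi> \<partial>lborel) = cis (- (2 * pi * (x \<bullet> u)) * t) * inverse_fourier \<phi> x"
      unfolding integral_lborel_affine[OF one_neq_zero m, of "- (t *\<^sub>R u)"] c inverse_fourier_def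
      by simp
    show "integrable lborel (\<lambda>\<xi>. \<phi> (\<xi> + t *\<^sub>R u) * ?c \<xi>)"
      unfolding integrable_lborel_affine[OF one_neq_zero m, of "- (t *\<^sub>R u)", symmetric] c
      using int by simp
  qed
  have "(\<integral>\<xi>. q k \<xi> * ?c \<xi> \<partial>lborel) = ((cis (- (2 * pi * (x \<bullet> u)) * e k) - cis (- (2 * pi * (x \<bullet> u)) * 0)) /\<^sub>R e k) * inverse_fourier \<phi> x" for k
  proof -
    have "(\<integral>\<xi>. q k \<xi> * ?c \<xi> \<partial>lborel) = (\<integral>\<xi>. (\<phi> (\<xi> + e k *\<^sub>R u) * ?c \<xi> - \<phi> (\<xi> + 0 *\<^sub>R u) * ?c \<xi>) /\<^sub>R e k \<partial>lborel)"
      by (simp add: q_def algebra_simps)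
    also have "\<dots> = ((\<integral>\<xi>. \<phi> (\<xi> + e k *\<^sub>R u) * ?c \<xi> \<partial>lborel) - (\<integral>\<xi>. \<phi> (\<xi> + 0 *\<^sub>R u) * ?c \<xi> \<partial>lborel)) /\<^sub>R e k"
      by (simp only: integral_scaleR_right Bochner_Integration.integral_diff[OF trans_int trans_int])
    finally show ?thesis unfolding trans by (simp add: algebra_simps)
  qed
  moreover have "(\<lambda>k. (cis (- (2 * pi * (x \<bullet> u)) * e k) - cis (- (2 * pi * (x \<bullet> u)) * 0)) /\<^sub>R e k) \<longlonglongrightarrow> - (\<i> * (2 * pi * (x \<bullet> u)))"
  proof (rule has_vector_derivative_sequentially[OF _ elim])
    let ?a = "- (\<i> * (2 * pi * (x \<bullet> u)))"
    have "cis (- (2 * pi * (x \<bullet> u)) * t) = exp (t *\<^sub>R ?a)" for t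
      by (simp add: cis_conv_exp scaleR_conv_of_real mult_ac)
    then show "((\<lambda>t. cis (- (2 * pi * (x \<bullet> u)) * t)) has_vector_derivative ?a) (at 0)"
      using exp_scaleR_has_vector_derivative_right[of ?a 0 UNIV] by simp
    show "e k \<noteq> 0" for k using e0[of k] by simp
  qed
  ultimately have "(\<lambda>k. \<integral>\<xi>. q k \<xi> * ?c \<xi> \<partial>lborel) \<longlonglongrightarrow> - (\<i> * (2 * pi * (x \<bullet> u))) * inverse_fourier \<phi> x"
    by (simp only: tendsto_mult_right)
  with L show ?thesis by (rule LIMSEQ_unique)
qed

lemma cmod_inverse_fourier_le:
  assumes "integrable lborel g"
  shows "cmod (inverse_fourier g x) \<le> (\<integral>\<xi>. cmod (g \<xi>) \<partial>lborel)"
proof -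
  have "cmod (inverse_fourier g x) \<le> (\<integral>\<xi>. cmod (g \<xi> * cis (2 * pi * (x \<bullet> \<xi>))) \<partial>lborel)"
    unfolding inverse_fourier_def by (rule integral_norm_bound)
  then show ?thesis by (simp add: norm_mult)
qed

definition rapid_decay :: "('a::euclidean_space \<Rightarrow> complex) \<Rightarrow> bool" where
  "rapid_decay f \<longleftrightarrow> (\<forall>N. \<exists>C. \<forall>x. (1 + norm x) ^ N * cmod (f x) \<le> C)"

text \<open>Multiplying the inverse transform by \<open>x \<bullet> u\<close> amounts to differentiating \<open>\<phi>\<close>, up to a factor of modulus
  \<open>2 * pi \<ge> 1\<close>, and the inverse transform of a test function is bounded by its \<open>L\<^sup>1\<close> norm.\<close>
lemma inverse_fourier_coordinate_decay:
  assumes \<phi>: "\<phi> \<in> test_functions UNIV"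
  shows "\<exists>C. \<forall>x. \<bar>x \<bullet> u\<bar> ^ N * cmod (inverse_fourier \<phi> x) \<le> C"
proof -
  define D where "D = (\<lambda>g \<xi>. frechet_derivative g (at \<xi>) u :: complex)"
  have "(D ^^ N) \<phi> \<in> test_functions UNIV \<and>
      (\<forall>x. inverse_fourier ((D ^^ N) \<phi>) x = (- (\<i> * (2 * pi * (x \<bullet> u)))) ^ N * inverse_fourier \<phi> x)"
  proof (induction N)
    case 0 show ?case using \<phi> by simp
  next
    case (Suc N)
    then show ?case
      using test_functions_directional_derivative[of "(D ^^ N) \<phi>" u]
        inverse_fourier_derivative[of "(D ^^ N) \<phi>" u]
      by (simp add: D_def)
  qed
  then have DN: "(D ^^ N) \<phi> \<in> test_functions UNIV"
    and eq: "\<And>x. inverse_fourier ((D ^^ N) \<phi>) x = (- (\<i> * (2 * pi * (x \<bullet> u)))) ^ N * inverse_fourier \<phi> x"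
    by auto
  have "\<bar>x \<bullet> u\<bar> ^ N * cmod (inverse_fourier \<phi> x) \<le> (\<integral>\<xi>. cmod ((D ^^ N) \<phi> \<xi>) \<partial>lborel)" for x
  proof -
    have "1 * \<bar>x \<bullet> u\<bar> \<le> (2 * pi) * \<bar>x \<bullet> u\<bar>"
      using pi_gt3 by (intro mult_right_mono) auto
    then have "\<bar>x \<bullet> u\<bar> ^ N \<le> (2 * pi * \<bar>x \<bullet> u\<bar>) ^ N"
      by (intro power_mono) auto
    then have "\<bar>x \<bullet> u\<bar> ^ N * cmod (inverse_fourier \<phi> x) \<le> (2 * pi * \<bar>x \<bullet> u\<bar>) ^ N * cmod (inverse_fourier \<phi> x)"
      by (intro mult_right_mono) auto
    also have "\<dots> = cmod (inverse_fourier ((D ^^ N) \<phi>) x)"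
      unfolding eq by (simp add: norm_mult norm_power abs_mult)
    also have "\<dots> \<le> (\<integral>\<xi>. cmod ((D ^^ N) \<phi> \<xi>) \<partial>lborel)"
      by (intro cmod_inverse_fourier_le test_functions_integrable DN)
    finally show ?thesis .
  qed
  then show ?thesis by blast
qed

text \<open>Decay along the coordinate axes controls decay in norm: some coordinate has size at least the norm
  divided by the square root of the dimension.\<close>
lemma one_plus_norm_power_le:
  fixes x :: "'a::euclidean_space"
  shows "(1 + norm x) ^ N \<le> 2 ^ N * (1 + sqrt DIM('a) ^ N * (\<Sum>b\<in>Basis. \<bar>x \<bullet> b\<bar> ^ N))"
proof -
  have "infnorm x \<in> (\<lambda>i. \<bar>x \<bullet> i\<bar>) ` Basis"
    unfolding infnorm_Max by (rule Max_in) auto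
  then obtain b where b: "b \<in> Basis" "infnorm x = \<bar>x \<bullet> b\<bar>" by auto
  have "norm x \<le> sqrt DIM('a) * \<bar>x \<bullet> b\<bar>"
    using norm_le_infnorm[of x] b by simp
  then have "norm x ^ N \<le> (sqrt DIM('a) * \<bar>x \<bullet> b\<bar>) ^ N"
    by (intro power_mono) auto
  also have "\<dots> = sqrt DIM('a) ^ N * \<bar>x \<bullet> b\<bar> ^ N" by (simp add: power_mult_distrib)
  also have "\<dots> \<le> sqrt DIM('a) ^ N * (\<Sum>b\<in>Basis. \<bar>x \<bullet> b\<bar> ^ N)"
    using b by (intro mult_left_mono member_le_sum) auto
  finally have n: "norm x ^ N \<le> sqrt DIM('a) ^ N * (\<Sum>b\<in>Basis. \<bar>x \<bullet> b\<bar> ^ N)" .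
  have "(1 + norm x) ^ N \<le> (2 * max 1 (norm x)) ^ N"
    by (intro power_mono) auto
  also have "\<dots> = 2 ^ N * max 1 (norm x) ^ N" by (simp add: power_mult_distrib)
  also have "max 1 (norm x) ^ N \<le> 1 + norm x ^ N"
    by (auto simp: max_def)
  finally show ?thesis using n by (smt (verit) mult_left_mono zero_le_power)
qed

lemma rapid_decay_inverse_fourier:
  fixes \<phi> :: "'a::euclidean_space \<Rightarrow> complex"
  assumes \<phi>: "\<phi> \<in> test_functions UNIV"
  shows "rapid_decay (inverse_fourier \<phi>)"
  unfolding rapid_decay_def
proof
  fix N
  let ?f = "inverse_fourier \<phi>"
  obtain C where C: "\<And>b x. \<bar>x \<bullet> b\<bar> ^ N * cmod (?f x) \<le> C b"
    using inverse_fourier_coordinate_decay[OF \<phi>, where N=N] by metis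
  obtain C0 where C0: "\<And>x. cmod (?f x) \<le> C0"
    using cmod_inverse_fourier_le[OF test_functions_integrable[OF \<phi>]] by blast
  have "(1 + norm x) ^ N * cmod (?f x) \<le> 2 ^ N * (C0 + sqrt DIM('a) ^ N * (\<Sum>b\<in>Basis. C b))" for x
  proof -
    have "(1 + norm x) ^ N * cmod (?f x) \<le> 2 ^ N * (1 + sqrt DIM('a) ^ N * (\<Sum>b\<in>Basis. \<bar>x \<bullet> b\<bar> ^ N)) * cmod (?f x)"
      by (intro mult_right_mono one_plus_norm_power_le) auto
    also have "\<dots> = 2 ^ N * (cmod (?f x) + sqrt DIM('a) ^ N * (\<Sum>b\<in>Basis. \<bar>x \<bullet> b\<bar> ^ N * cmod (?f x)))"
      by (simp add: algebra_simps sum_distrib_left sum_distrib_right)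
    also have "\<dots> \<le> 2 ^ N * (C0 + sqrt DIM('a) ^ N * (\<Sum>b\<in>Basis. C b))"
      using C C0 by (intro mult_left_mono add_mono sum_mono) auto
    finally show ?thesis .
  qed
  then show "\<exists>C. \<forall>x. (1 + norm x) ^ N * cmod (?f x) \<le> C" by blast
qed

text \<open>With exponent \<open>2 * DIM('a)\<close> each coordinate gets its own factor \<open>(1 + norm x)\<^sup>2 \<ge> 1 + (x \<bullet> b)\<^sup>2\<close>, so a product
  of one-dimensional Cauchy densities dominates.\<close>
lemma integrable_inverse_power_norm:
  "integrable lborel (\<lambda>x::'a::euclidean_space. inverse ((1 + norm x) ^ (2 * DIM('a))))"
proof (rule Bochner_Integration.integrable_bound)
  have "integrable lborel (\<lambda>t::real. inverse (1 + t\<^sup>2))"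
    using integrable_inverse_1_plus_square by (simp add: set_integrable_def einterval_eq)
  then show "integrable lborel (\<lambda>x::'a. \<Prod>b\<in>Basis. inverse (1 + (x \<bullet> b)\<^sup>2))"
    by (rule integrable_lborel_prod)
  show "AE x in lborel. norm (inverse ((1 + norm (x::'a)) ^ (2 * DIM('a)))) \<le> norm (\<Prod>b\<in>Basis. inverse (1 + (x \<bullet> b)\<^sup>2))"
  proof (rule AE_I2)
    fix x :: 'a
    have "inverse ((1 + norm x) ^ (2 * DIM('a))) = (\<Prod>b\<in>(Basis::'a set). inverse ((1 + norm x)\<^sup>2))"
      by (simp add: power_mult power_inverse)
    also have "\<dots> \<le> (\<Prod>b\<in>Basis. inverse (1 + (x \<bullet> b)\<^sup>2))"
    proof (intro prod_mono conjI le_imp_inverse_le)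
      fix b :: 'a assume b: "b \<in> Basis"
      have "(x \<bullet> b)\<^sup>2 \<le> (norm x)\<^sup>2"
        using Basis_le_norm[OF b, of x] by (metis abs_ge_zero power2_abs power_mono)
      then show "1 + (x \<bullet> b)\<^sup>2 \<le> (1 + norm x)\<^sup>2"
        using norm_ge_zero[of x] by (simp add: power2_sum del: norm_ge_zero)
    qed (auto intro: add_pos_nonneg)
    finally show "norm (inverse ((1 + norm x) ^ (2 * DIM('a)))) \<le> norm (\<Prod>b\<in>Basis. inverse (1 + (x \<bullet> b)\<^sup>2))"
      by (simp add: prod_nonneg)
  qed
qed measurable

lemma rapid_decay_integrable:
  fixes f :: "'a::euclidean_space \<Rightarrow> complex"
  assumes "rapid_decay f" and [measurable]: "f \<in> borel_measurable borel"
  shows "integrable lborel (\<lambda>x. (1 + norm x) ^ N * cmod (f x))"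
proof -
  obtain C where C: "\<And>x. (1 + norm x) ^ (N + 2 * DIM('a)) * cmod (f x) \<le> C"
    using assms(1) unfolding rapid_decay_def by blast
  show ?thesis
  proof (rule Bochner_Integration.integrable_bound)
    show "integrable lborel (\<lambda>x::'a. C * inverse ((1 + norm x) ^ (2 * DIM('a))))"
      by (intro integrable_mult_right integrable_inverse_power_norm)
    show "AE x in lborel. norm ((1 + norm x) ^ N * cmod (f x)) \<le> norm (C * inverse ((1 + norm x) ^ (2 * DIM('a))))"
    proof (rule AE_I2)
      fix x :: 'a
      have p: "(1 + norm x) ^ (2 * DIM('a)) > 0" 
        by (intro zero_less_power) (simp add: add_pos_nonneg)
      have "(1 + norm x) ^ N * cmod (f x) * (1 + norm x) ^ (2 * DIM('a)) \<le> C"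
        using C[of x] by (simp add: power_add mult_ac)
      then have "(1 + norm x) ^ N * cmod (f x) \<le> C * inverse ((1 + norm x) ^ (2 * DIM('a)))"
        using p by (simp add: field_simps)
      moreover have "0 \<le> (1 + norm x) ^ N * cmod (f x)" by simp
      ultimately show "norm ((1 + norm x) ^ N * cmod (f x)) \<le> norm (C * inverse ((1 + norm x) ^ (2 * DIM('a))))"
        by (metis abs_of_nonneg abs_ge_self order_trans real_norm_def)
    qed
  qed measurable
qed

section \<open>Closed matrix groups and the dual action\<close>

lemma bounded_bilinear_matrix_mult:
  "bounded_bilinear ((**) :: real^'n^'m \<Rightarrow> real^'k^'n \<Rightarrow> real^'k^'m)"
  unfolding bilinear_conv_bounded_bilinear[symmetric] bilinear_def
  by (auto intro!: linearI simp: matrix_matrix_mult_def vec_eq_iff sum.distrib algebra_simps sum_distrib_left)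

lemma bounded_bilinear_matrix_vector_mult:
  "bounded_bilinear ((*v) :: real^'n^'m \<Rightarrow> real^'n \<Rightarrow> real^'m)"
  unfolding bilinear_conv_bounded_bilinear[symmetric] bilinear_def
  by (auto intro!: linearI simp: matrix_vector_mult_def vec_eq_iff sum.distrib algebra_simps sum_distrib_left)

lemmas continuous_on_matrix_mult [continuous_intros] =
  bounded_bilinear.continuous_on[OF bounded_bilinear_matrix_mult]
lemmas continuous_on_matrix_vector_mult [continuous_intros] =
  bounded_bilinear.continuous_on[OF bounded_bilinear_matrix_vector_mult]

lemma continuous_on_transpose [continuous_intros]:
  fixes f :: "'a::topological_space \<Rightarrow> real^'n^'m"
  assumes "continuous_on S f"
  shows "continuous_on S (\<lambda>x. transpose (f x))"
  unfolding transpose_def by (intro continuous_intros assms)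

lemma continuous_on_det [continuous_intros]:
  fixes f :: "'a::topological_space \<Rightarrow> real^'n^'n"
  assumes "continuous_on S f"
  shows "continuous_on S (\<lambda>x. det (f x))"
  unfolding det_def by (intro continuous_intros assms)

lemma matrix_inv_inverse:
  fixes A :: "'a::semiring_1^'n^'m"
  assumes "invertible A"
  shows "A ** matrix_inv A = mat 1" "matrix_inv A ** A = mat 1"
proof -
  have "A ** matrix_inv A = mat 1 \<and> matrix_inv A ** A = mat 1"
    unfolding matrix_inv_def by (rule someI_ex) (use assms in \<open>simp add: invertible_def\<close>)
  then show "A ** matrix_inv A = mat 1" "matrix_inv A ** A = mat 1" by auto
qed

lemma matrix_inv_unique:
  fixes A :: "real^'n^'n"
  assumes "A ** B = mat 1"
  shows "invertible A" "matrix_inv A = B"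
proof -
  have BA: "B ** A = mat 1" using assms matrix_left_right_inverse by blast
  then show i: "invertible A" using assms unfolding invertible_def by blast
  have "matrix_inv A = (B ** A) ** matrix_inv A" by (simp add: BA)
  also have "\<dots> = B" unfolding matrix_mul_assoc[symmetric] by (simp add: matrix_inv_inverse[OF i])
  finally show "matrix_inv A = B" .
qed

locale closed_matrix_subgroup =
  fixes H :: "(real^'n^'n) set"
  assumes closed_group: "closed_matrix_group H"
begin

lemma one_in: "mat 1 \<in> H"
  and mult_in: "g \<in> H \<Longrightarrow> h \<in> H \<Longrightarrow> g ** h \<in> H"
  and inv_in: "h \<in> H \<Longrightarrow> matrix_inv h \<in> H"
  using closed_group by (auto simp: closed_matrix_group_def)

lemma invertible_in: "h \<in> H \<Longrightarrow> invertible h"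
  using closed_group closedin_subset unfolding closed_matrix_group_def by fastforce

lemma det_nz: "h \<in> H \<Longrightarrow> det h \<noteq> 0"
  using invertible_in invertible_det_nz by blast

lemma inv_right: "h \<in> H \<Longrightarrow> h ** matrix_inv h = mat 1"
  and inv_left: "h \<in> H \<Longrightarrow> matrix_inv h ** h = mat 1"
  using matrix_inv_inverse[OF invertible_in] by auto

lemma inv_inv: "h \<in> H \<Longrightarrow> matrix_inv (matrix_inv h) = h"
  by (rule matrix_inv_unique(2)) (rule inv_left)

lemma inv_mult: 
  assumes "g \<in> H" "h \<in> H"
  shows "matrix_inv (g ** h) = matrix_inv h ** matrix_inv g"
proof (rule matrix_inv_unique(2))
  have "g ** h ** (matrix_inv h ** matrix_inv g) = g ** (h ** matrix_inv h) ** matrix_inv g"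
    by (simp add: matrix_mul_assoc)
  then show "g ** h ** (matrix_inv h ** matrix_inv g) = mat 1"
    by (simp add: inv_right assms)
qed

text \<open>An exhaustion of \<open>H\<close> by compact sets. Bounding the inverse as well keeps the sets away from the
  singular matrices, and it makes them stable under inversion.\<close>
definition group_ball :: "real \<Rightarrow> (real^'n^'n) set" where
  "group_ball R = {h \<in> H. norm h \<le> R \<and> norm (matrix_inv h) \<le> R}"

lemma group_ball_subset: "group_ball R \<subseteq> H"
  by (auto simp: group_ball_def)

lemma group_ball_mono: "R \<le> S \<Longrightarrow> group_ball R \<subseteq> group_ball S"
  by (auto simp: group_ball_def)

lemma group_ball_exhausts: "h \<in> H \<Longrightarrow> \<exists>n::nat. h \<in> group_ball (real n)"
  using real_arch_simple[of "max (norm h) (norm (matrix_inv h))"]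
  by (auto simp: group_ball_def)

lemma group_ball_inv: "h \<in> group_ball R \<Longrightarrow> matrix_inv h \<in> group_ball R"
  by (auto simp: group_ball_def inv_in inv_inv)

lemma group_ball_mult: "\<exists>T. \<forall>g\<in>group_ball R. \<forall>h\<in>group_ball S. g ** h \<in> group_ball T"
proof -
  obtain K where K: "K > 0" "\<And>(A :: real^'n^'n) (B :: real^'n^'n). norm (A ** B) \<le> norm A * norm B * K"
    using bounded_bilinear.pos_bounded[OF bounded_bilinear_matrix_mult] by blast
  have le: "norm (A ** B) \<le> \<bar>R\<bar> * \<bar>S\<bar> * K" if "norm A * norm B \<le> \<bar>R\<bar> * \<bar>S\<bar>" for A B :: "real^'n^'n"
    using K(2)[of A B] that K(1) by (meson less_imp_le mult_right_mono order_trans)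
  have "g ** h \<in> group_ball (\<bar>R\<bar> * \<bar>S\<bar> * K)" if "g \<in> group_ball R" "h \<in> group_ball S" for g h
  proof -
    have g: "g \<in> H" "norm g \<le> \<bar>R\<bar>" "norm (matrix_inv g) \<le> \<bar>R\<bar>"
      and h: "h \<in> H" "norm h \<le> \<bar>S\<bar>" "norm (matrix_inv h) \<le> \<bar>S\<bar>"
      using that by (auto simp: group_ball_def)
    have "norm g * norm h \<le> \<bar>R\<bar> * \<bar>S\<bar>" "norm (matrix_inv g) * norm (matrix_inv h) \<le> \<bar>R\<bar> * \<bar>S\<bar>"
      using g h by (auto intro!: mult_mono)
    then show ?thesis
      unfolding group_ball_def mem_Collect_eq inv_mult[OF g(1) h(1)]
      using le mult_in g h by (simp add: mult.commute)
  qed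
  then show ?thesis by blast
qed

text \<open>The pairs of a matrix and its inverse form a closed set, so those with both norms at most \<open>R\<close> form
  a compact set, and \<open>group_ball R\<close> is its projection.\<close>
lemma compact_group_ball: "compact (group_ball R)"
proof -
  obtain T where T: "closed T" and HT: "\<And>A. A \<in> H \<longleftrightarrow> invertible A \<and> A \<in> T"
    using closed_group unfolding closed_matrix_group_def closedin_closed by auto
  let ?P = "(cball 0 R \<times> cball 0 R) \<inter> ((T \<times> UNIV) \<inter> {p. fst p ** snd p = (mat 1 :: real^'n^'n)})"
  have "closed {p. fst p ** snd p = (mat 1 :: real^'n^'n)}"
    by (intro closed_Collect_eq continuous_intros)
  then have "compact ?P"
    by (intro compact_Int_closed compact_Times compact_cball closed_Int closed_Times T closed_UNIV)
  then have "compact (fst ` ?P)"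
    by (intro compact_continuous_image continuous_intros)
  moreover have "fst ` ?P = group_ball R"
  proof
    show "fst ` ?P \<subseteq> group_ball R"
    proof
      fix h assume "h \<in> fst ` ?P"
      then obtain g where "norm h \<le> R" "norm g \<le> R" "h \<in> T" "h ** g = mat 1" by auto
      then show "h \<in> group_ball R"
        using matrix_inv_unique[of h g] HT by (simp add: group_ball_def)
    qed
    show "group_ball R \<subseteq> fst ` ?P"
    proof
      fix h assume h: "h \<in> group_ball R"
      then have "(h, matrix_inv h) \<in> ?P"
        using inv_right[of h] HT by (auto simp: group_ball_def)
      then show "h \<in> fst ` ?P" by force
    qed
  qed
  ultimately show ?thesis by simp
qed

text \<open>If \<open>h = 1 + e\<close> with \<open>e\<close> small, then \<open>h\<^sup>-\<^sup>1 = 1 - e h\<^sup>-\<^sup>1\<close>, and the last term is absorbed into the left-hand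
  side. The radius \<open>1 / (2 * K)\<close> makes the absorbed term at most half of the norm of the inverse.\<close>
lemma ball_one_subset_group_ball: "\<exists>r>0. \<exists>R. H \<inter> cball (mat 1) r \<subseteq> group_ball R"
proof -
  obtain K where K: "K > 0" "\<And>(A :: real^'n^'n) (B :: real^'n^'n). norm (A ** B) \<le> norm A * norm B * K"
    using bounded_bilinear.pos_bounded[OF bounded_bilinear_matrix_mult] by blast
  let ?r = "1 / (2 * K)" and ?one = "norm (mat 1 :: real^'n^'n)"
  have "h \<in> group_ball (2 * ?one + ?r)" if h: "h \<in> H" "norm (h - mat 1) \<le> ?r" for h
  proof -
    let ?g = "matrix_inv h"
    have "norm h \<le> norm (mat 1 + (h - mat 1))" by simp
    also have "\<dots> \<le> ?one + ?r" using h(2) norm_triangle_ineq order_trans add_left_mono by blast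
    finally have 1: "norm h \<le> 2 * ?one + ?r"
      using norm_ge_zero[of "mat 1 :: real^'n^'n"] by linarith
    have "(h - mat 1) ** ?g = mat 1 - ?g"
      using inv_right[OF h(1)] by (simp add: bounded_bilinear.diff_left[OF bounded_bilinear_matrix_mult])
    then have "norm ?g = norm (mat 1 - (h - mat 1) ** ?g)" by simp
    also have "\<dots> \<le> ?one + norm ((h - mat 1) ** ?g)" by (rule norm_triangle_ineq4)
    also have "norm ((h - mat 1) ** ?g) \<le> norm (h - mat 1) * norm ?g * K" by (rule K(2))
    also have "\<dots> \<le> ?r * norm ?g * K"
      using h(2) K(1) by (intro mult_right_mono) auto
    also have "\<dots> = norm ?g / 2" using K(1) by simp
    finally have "norm ?g \<le> 2 * ?one" by simp
    moreover have "0 \<le> ?r" using K(1) by simp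
    ultimately have "norm ?g \<le> 2 * ?one + ?r" by linarith
    with 1 show ?thesis using h(1) by (simp add: group_ball_def)
  qed
  moreover have "?r > 0" using K(1) by simp
  ultimately show ?thesis
    by (intro exI[of _ ?r] conjI exI[of _ "2 * ?one + ?r"]) (auto simp: dist_norm norm_minus_commute)
qed

lemma group_ball_bounds_continuous:
  assumes "continuous_on H f"
  shows "\<exists>B\<ge>0. \<forall>h\<in>group_ball R. \<bar>f h :: real\<bar> \<le> B"
proof -
  have "bounded (f ` group_ball R)"
    using continuous_on_subset[OF assms group_ball_subset] compact_group_ball
    by (intro compact_imp_bounded compact_continuous_image)
  then obtain B where "B > 0" "\<forall>y\<in>f ` group_ball R. norm y \<le> B"
    using bounded_pos by blast
  then show ?thesis by (intro exI[of _ B]) auto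
qed

lemma dual_action_mult:
  fixes \<xi> :: "real^'n"
  shows "transpose (a ** b) *v \<xi> = transpose b *v (transpose a *v \<xi>)"
  unfolding matrix_transpose_mul matrix_vector_mul_assoc ..

lemma dual_action_one:
  fixes \<xi> :: "real^'n"
  shows "transpose (mat 1) *v \<xi> = \<xi>"
  unfolding transpose_mat by (rule matrix_vector_mul_lid)

lemma continuous_on_orbit_map: "continuous_on S (\<lambda>h::real^'n^'n. transpose h *v \<xi>)"
  by (intro continuous_intros)

text \<open>The open orbit is a countable union of the compact sets \<open>group_ball n \<cdot> \<xi>\<close>; by the Baire category
  theorem they cannot all have empty interior.\<close>
lemma orbit_map_interior:
  assumes "open (dual_orbit H \<xi>)"
  shows "\<exists>n::nat. interior ((\<lambda>h. transpose h *v \<xi>) ` group_ball (real n)) \<noteq> {}"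
proof (rule ccontr)
  let ?p = "\<lambda>h::real^'n^'n. transpose h *v \<xi>"
  assume "\<not> ?thesis"
  then have empty: "interior (?p ` group_ball (real n)) = {}" for n by blast
  let ?\<G> = "range (\<lambda>n::nat. - (?p ` group_ball (real n)))"
  have "UNIV \<subseteq> closure (\<Inter>?\<G>)"
  proof (rule Baire)
    fix T assume "T \<in> ?\<G>"
    then obtain n where T: "T = - (?p ` group_ball (real n))" by blast
    have "compact (?p ` group_ball (real n))"
      by (intro compact_continuous_image continuous_on_orbit_map compact_group_ball)
    then have "open T" unfolding T by (intro open_Compl compact_imp_closed)
    moreover have "closure T = UNIV" unfolding T closure_complement empty by simp
    ultimately show "openin (top_of_set UNIV) T \<and> UNIV \<subseteq> closure T" by simp
  qed auto
  moreover have "\<Inter>?\<G> \<subseteq> - dual_orbit H \<xi>"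
    using group_ball_exhausts by (fastforce simp: dual_orbit_def)
  moreover have "closed (- dual_orbit H \<xi>)" using assms by (rule closed_Compl)
  ultimately have "dual_orbit H \<xi> = {}"
    using closure_minimal by blast
  moreover have "?p (mat 1) \<in> dual_orbit H \<xi>"
    unfolding dual_orbit_def using one_in by (rule imageI)
  ultimately show False by simp
qed

text \<open>One interior point of the image of some \<open>group_ball\<close> suffices: an element of \<open>H\<close> carries it to any other
  point of the orbit, and this enlarges the compact set in \<open>H\<close> only to another one. So the interiors
  of the images of the exhaustion cover the orbit, and finitely many of them cover \<open>K\<close>.\<close>
lemma compact_subset_orbit:
  assumes orb: "open (dual_orbit H \<xi>)" and K: "compact K" "K \<subseteq> dual_orbit H \<xi>"
  shows "\<exists>R. K \<subseteq> (\<lambda>h. transpose h *v \<xi>) ` group_ball R"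
proof -
  let ?p = "\<lambda>h::real^'n^'n. transpose h *v \<xi>"
  obtain n l where l: "l \<in> group_ball (real n)" "?p l \<in> interior (?p ` group_ball (real n))"
    using orbit_map_interior[OF orb] interior_subset by blast
  have lH: "l \<in> H" using l group_ball_subset by blast
  have "\<exists>m::nat. \<eta> \<in> interior (?p ` group_ball (real m))" if \<eta>: "\<eta> \<in> K" for \<eta>
  proof -
    obtain g where g: "g \<in> H" "\<eta> = ?p g" using \<eta> K unfolding dual_orbit_def by blast
    let ?k = "matrix_inv l ** g"
    have kH: "?k \<in> H" using g lH by (intro mult_in inv_in)
    then obtain n' where "?k \<in> group_ball (real n')" using group_ball_exhausts by blast
    then obtain T where T: "\<And>a. a \<in> group_ball (real n) \<Longrightarrow> a ** ?k \<in> group_ball T"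
      using group_ball_mult[of "real n" "real n'"] by blast
    obtain m :: nat where m: "T \<le> real m" using real_arch_simple by blast
    let ?t = "\<lambda>\<zeta>. transpose ?k *v \<zeta>"
    have "surj ?t"
    proof (rule surjI)
      fix \<zeta>
      have "?t (transpose (matrix_inv ?k) *v \<zeta>) = transpose (matrix_inv ?k ** ?k) *v \<zeta>"
        by (rule dual_action_mult[symmetric])
      then show "?t (transpose (matrix_inv ?k) *v \<zeta>) = \<zeta>"
        unfolding inv_left[OF kH] dual_action_one .
    qed
    then have "open (?t ` interior (?p ` group_ball (real n)))"
      by (intro open_surjective_linear_image open_interior matrix_vector_mul_linear)
    moreover have "?t ` interior (?p ` group_ball (real n)) \<subseteq> ?p ` group_ball (real m)"
    proof -
      have "?t ` ?p ` group_ball (real n) \<subseteq> ?p ` group_ball (real m)"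
        unfolding image_image dual_action_mult[symmetric]
        using T group_ball_mono[OF m] by blast
      then show ?thesis using interior_subset by blast
    qed
    ultimately have "?t ` interior (?p ` group_ball (real n)) \<subseteq> interior (?p ` group_ball (real m))"
      by (rule interior_maximal[rotated])
    moreover have "?t (?p l) = \<eta>"
    proof -
      have "l ** ?k = g" by (simp add: matrix_mul_assoc inv_right lH)
      then show ?thesis unfolding dual_action_mult[symmetric] g(2) by simp
    qed
    ultimately show ?thesis using l(2) by blast
  qed
  then have "K \<subseteq> (\<Union>m\<in>UNIV. interior (?p ` group_ball (real m)))" by blast
  then obtain C where C: "finite C" "K \<subseteq> (\<Union>m\<in>C. interior (?p ` group_ball (real m)))"
    using compactE_image[OF K(1), of UNIV "\<lambda>m::nat. interior (?p ` group_ball (real m))"] by auto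
  have "K \<subseteq> ?p ` group_ball (real (Max C))"
  proof
    fix \<eta> assume "\<eta> \<in> K"
    then obtain m where "m \<in> C" "\<eta> \<in> ?p ` group_ball (real m)"
      using C interior_subset by blast
    then show "\<eta> \<in> ?p ` group_ball (real (Max C))"
      using group_ball_mono[of "real m" "real (Max C)"] C(1) by auto
  qed
  then show ?thesis by blast
qed

text \<open>Write \<open>\<eta> = a\<^sup>T \<xi>\<close> and \<open>h\<^sup>T \<eta> = b\<^sup>T \<xi>\<close> with \<open>a\<close> and \<open>b\<close> in one compact set. Then \<open>s = a h b\<^sup>-\<^sup>1\<close> stabilises \<open>\<xi>\<close>, so
  that \<open>h = a\<^sup>-\<^sup>1 s b\<close> is a product of elements of compact sets.\<close>
lemma dual_action_proper:
  assumes orb: "open (dual_orbit H \<xi>)" and stab: "compact (dual_stabilizer H \<xi>)"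
    and K: "compact K" "K \<subseteq> dual_orbit H \<xi>"
  shows "\<exists>R. \<forall>h\<in>H. \<forall>\<eta>\<in>K. transpose h *v \<eta> \<in> K \<longrightarrow> h \<in> group_ball R"
proof -
  obtain M where M: "K \<subseteq> (\<lambda>h. transpose h *v \<xi>) ` group_ball M"
    using compact_subset_orbit[OF orb K] by blast
  obtain S where S: "\<And>h. h \<in> dual_stabilizer H \<xi> \<Longrightarrow> norm h \<le> S"
    using compact_imp_bounded[OF stab] unfolding bounded_iff by blast
  have stab_ball: "h \<in> group_ball S" if h: "h \<in> dual_stabilizer H \<xi>" for h
  proof -
    have hH: "h \<in> H" and fixed: "transpose h *v \<xi> = \<xi>" using h unfolding dual_stabilizer_def by blast+
    have "transpose (matrix_inv h) *v \<xi> = transpose (matrix_inv h) *v (transpose h *v \<xi>)"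
      unfolding fixed ..
    also have "\<dots> = \<xi>"
      unfolding dual_action_mult[symmetric] inv_right[OF hH] by (rule dual_action_one)
    finally have "matrix_inv h \<in> dual_stabilizer H \<xi>"
      unfolding dual_stabilizer_def using inv_in[OF hH] by blast
    then show ?thesis using S h hH unfolding group_ball_def by blast
  qed
  obtain T1 where T1: "\<And>g h. g \<in> group_ball M \<Longrightarrow> h \<in> group_ball S \<Longrightarrow> g ** h \<in> group_ball T1"
    using group_ball_mult[of M S] by blast
  obtain T2 where T2: "\<And>g h. g \<in> group_ball T1 \<Longrightarrow> h \<in> group_ball M \<Longrightarrow> g ** h \<in> group_ball T2"
    using group_ball_mult[of T1 M] by blast
  have "h \<in> group_ball T2" if hH: "h \<in> H" and \<eta>: "\<eta> \<in> K" "transpose h *v \<eta> \<in> K" for h \<eta>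
  proof -
    obtain a where a: "a \<in> group_ball M" "\<eta> = transpose a *v \<xi>" using \<eta> M by blast
    obtain b where b: "b \<in> group_ball M" "transpose h *v \<eta> = transpose b *v \<xi>" using \<eta> M by blast
    have aH: "a \<in> H" and bH: "b \<in> H" using a b group_ball_subset by blast+
    let ?s = "a ** h ** matrix_inv b"
    have "transpose ?s *v \<xi> = transpose (matrix_inv b) *v (transpose b *v \<xi>)"
      unfolding dual_action_mult a(2)[symmetric] b(2) ..
    also have "\<dots> = \<xi>"
      unfolding dual_action_mult[symmetric] inv_right[OF bH] by (rule dual_action_one)
    finally have "?s \<in> dual_stabilizer H \<xi>"
      unfolding dual_stabilizer_def using aH bH hH by (blast intro: mult_in inv_in)
    then have "matrix_inv a ** ?s ** b \<in> group_ball T2"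
      by (intro T2 T1 stab_ball group_ball_inv a b)
    also have "matrix_inv a ** ?s ** b = (matrix_inv a ** a) ** h ** (matrix_inv b ** b)"
      by (simp only: matrix_mul_assoc)
    also have "\<dots> = h" by (simp add: inv_left aH bH)
    finally show ?thesis .
  qed
  then show ?thesis by blast
qed

end

section \<open>The wavelet transform on the Fourier side and its decay\<close>

lemma test_functions_UNIV: "test_functions S \<subseteq> test_functions UNIV"
  by (auto simp: test_functions_def)

lemma borel_measurable_inverse_fourier [measurable]:
  assumes [measurable]: "g \<in> borel_measurable borel"
  shows "inverse_fourier g \<in> borel_measurable borel"
  unfolding inverse_fourier_def by (rule lborel.borel_measurable_lebesgue_integral) measurable

lemma inner_matrix_vector: "(h *v u) \<bullet> \<xi> = u \<bullet> (transpose h *v \<xi>)"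
  for h :: "real^'n^'m" and u :: "real^'n"
  using dot_lmul_matrix[of \<xi> h u] by (simp add: inner_commute)

lemma borel_measurable_cnj [measurable]: "cnj \<in> borel_measurable borel"
  by (intro borel_measurable_continuous_onI continuous_intros)

lemma cis_minus: "cis (- t) = cnj (cis t)"
  by (simp add: cis_cnj)

text \<open>Insert the inversion formula for \<open>f\<close>, interchange the integrals, and substitute \<open>y = x + h u\<close>. The
  Jacobian \<open>\<bar>det h\<bar>\<close> and the normalisation \<open>\<bar>det h\<bar> powr (- 1/2)\<close> combine to the square root. Only the values
  of \<open>\<phi>\<close> and \<open>fourier g\<close> enter the result.\<close>
lemma wavelet_transform_fourier:
  fixes f g :: "real^'n \<Rightarrow> complex"
  assumes g: "integrable lborel g" and \<phi>: "integrable lborel \<phi>"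
    and f: "AE y in lborel. f y = inverse_fourier \<phi> y"
    and [measurable]: "f \<in> borel_measurable borel"
    and inv: "invertible h"
  shows "wavelet_transform g f (x, h) = complex_of_real (sqrt \<bar>det h\<bar>) *
     (\<integral>\<xi>. \<phi> \<xi> * cnj (fourier g (transpose h *v \<xi>)) * cis (2 * pi * (x \<bullet> \<xi>)) \<partial>lborel)"
proof -
  have [measurable]: "\<phi> \<in> borel_measurable borel" "g \<in> borel_measurable borel"
    using \<phi> g by (auto dest: borel_measurable_integrable)
  let ?k = "matrix_inv h" and ?c = "\<bar>det h\<bar> powr (- 1/2)"
  have d: "det h \<noteq> 0" using inv invertible_det_nz by blast
  have dk: "det ?k \<noteq> 0"
    using matrix_inv_inverse(1)[OF inv] by (metis det_I det_mul mult_zero_right zero_neq_one)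
  define G where "G y = complex_of_real ?c * g (?k *v (y - x))" for y
  have [measurable]: "G \<in> borel_measurable borel" unfolding G_def by measurable
  have "integrable lborel (\<lambda>y. g (?k *v (- x) + ?k *v y))"
    unfolding integrable_lborel_matrix_affine[OF dk \<open>g \<in> borel_measurable borel\<close>] by (rule g)
  then have G: "integrable lborel G"
    unfolding G_def by (intro integrable_mult_right) (simp flip: matrix_vector_right_distrib)
  let ?F = "\<lambda>\<xi> y. \<phi> \<xi> * cis (2 * pi * (y \<bullet> \<xi>)) * cnj (G y)"
  have "wavelet_transform g f (x, h) = (\<integral>y. f y * cnj (G y) \<partial>lborel)"
    by (simp add: wavelet_transform_def L2_inner_def quasi_regular_def G_def)
  also have "\<dots> = (\<integral>y. inverse_fourier \<phi> y * cnj (G y) \<partial>lborel)"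
    by (rule integral_cong_AE) (use f in auto)
  also have "\<dots> = (\<integral>y. (\<integral>\<xi>. ?F \<xi> y \<partial>lborel) \<partial>lborel)"
    unfolding inverse_fourier_def integral_mult_left_zero ..
  also have "\<dots> = (\<integral>\<xi>. (\<integral>y. ?F \<xi> y \<partial>lborel) \<partial>lborel)"
  proof (rule Fubini_lborel_bound[OF _ integrable_norm[OF \<phi>] integrable_norm[OF G]])
    show "(\<lambda>(\<xi>, y). ?F \<xi> y) \<in> borel_measurable borel"
      unfolding borel_prod[symmetric] by measurable
  qed (simp add: norm_mult)
  also have "\<dots> = (\<integral>\<xi>. complex_of_real (sqrt \<bar>det h\<bar>) * (\<phi> \<xi> * cnj (fourier g (transpose h *v \<xi>)) * cis (2 * pi * (x \<bullet> \<xi>))) \<partial>lborel)"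
  proof (intro Bochner_Integration.integral_cong refl)
    fix \<xi> :: "real^'n"
    have u: "?k *v (x + h *v u - x) = u" for u
      by (simp add: matrix_vector_mul_assoc matrix_inv_inverse[OF inv])
    have "(\<integral>y. cis (2 * pi * (y \<bullet> \<xi>)) * cnj (G y) \<partial>lborel)
       = \<bar>det h\<bar> *\<^sub>R (\<integral>u. cis (2 * pi * ((x + h *v u) \<bullet> \<xi>)) * cnj (G (x + h *v u)) \<partial>lborel)"
      by (rule integral_lborel_matrix_affine[OF d]) measurable
    also have "\<dots> = \<bar>det h\<bar> *\<^sub>R (\<integral>u. (complex_of_real ?c * cis (2 * pi * (x \<bullet> \<xi>))) *
        cnj (g u * cis (- (2 * pi * (u \<bullet> (transpose h *v \<xi>))))) \<partial>lborel)"
    proof -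
      have "cis (2 * pi * ((x + h *v u) \<bullet> \<xi>)) = cis (2 * pi * (x \<bullet> \<xi>)) * cis (2 * pi * (u \<bullet> (transpose h *v \<xi>)))" for u
        unfolding cis_mult inner_add_left inner_matrix_vector by (simp only: distrib_left)
      then show ?thesis
        unfolding G_def u cis_minus by (simp only: complex_cnj_mult complex_cnj_cnj complex_cnj_complex_of_real mult_ac)
    qed
    also have "\<dots> = \<bar>det h\<bar> *\<^sub>R ((complex_of_real ?c * cis (2 * pi * (x \<bullet> \<xi>))) * cnj (fourier g (transpose h *v \<xi>)))"
      unfolding fourier_cis integral_mult_right_zero Bochner_Integration.integral_cnj ..
    also have "\<dots> = complex_of_real (\<bar>det h\<bar> * ?c) * (cis (2 * pi * (x \<bullet> \<xi>)) * cnj (fourier g (transpose h *v \<xi>)))"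
      by (simp only: scaleR_conv_of_real of_real_mult mult.assoc)
    also have "\<bar>det h\<bar> * ?c = sqrt \<bar>det h\<bar>"
      using powr_mult_base[of "\<bar>det h\<bar>" "-1/2"] by (simp add: powr_half_sqrt)
    finally have "\<phi> \<xi> * (\<integral>y. cis (2 * pi * (y \<bullet> \<xi>)) * cnj (G y) \<partial>lborel) =
      \<phi> \<xi> * (complex_of_real (sqrt \<bar>det h\<bar>) * (cis (2 * pi * (x \<bullet> \<xi>)) * cnj (fourier g (transpose h *v \<xi>))))"
      by (rule arg_cong)
    then show "(\<integral>y. ?F \<xi> y \<partial>lborel) = complex_of_real (sqrt \<bar>det h\<bar>) * (\<phi> \<xi> * cnj (fourier g (transpose h *v \<xi>)) * cis (2 * pi * (x \<bullet> \<xi>)))"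
      unfolding mult.assoc[of "\<phi> \<xi>"] integral_mult_right_zero by (simp only: mult_ac)
  qed
  finally show ?thesis unfolding integral_mult_right_zero .
qed

text \<open>The inverse transform \<open>f\<close> of \<open>fourier \<psi>\<close> has the Fourier transform of \<open>\<psi>\<close>, so both have the same wavelet
  transform everywhere on the group, while \<open>f\<close> has pointwise decay that \<open>\<psi>\<close> itself has only almost
  everywhere.\<close>
lemma fourier_test_function_representative:
  fixes \<psi> :: "real^'n \<Rightarrow> complex"
  assumes "\<psi> \<in> fourier_test_functions S"
  defines "\<phi> \<equiv> fourier \<psi>"
  defines "f \<equiv> inverse_fourier \<phi>"
  shows "rapid_decay f" "f \<in> borel_measurable borel"
    and "invertible h \<Longrightarrow> wavelet_transform \<psi> \<psi> (x, h) = complex_of_real (sqrt \<bar>det h\<bar>) *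
          (\<integral>\<xi>. \<phi> \<xi> * cnj (\<phi> (transpose h *v \<xi>)) * cis (2 * pi * (x \<bullet> \<xi>)) \<partial>lborel)"
    and "invertible h \<Longrightarrow> wavelet_transform \<psi> \<psi> (x, h) = wavelet_transform f f (x, h)"
proof -
  have \<psi>: "integrable lborel \<psi>" and \<phi>: "\<phi> \<in> test_functions UNIV"
    using assms(1) test_functions_UNIV unfolding fourier_test_functions_def \<phi>_def by blast+
  have i\<phi>: "integrable lborel \<phi>" by (rule test_functions_integrable[OF \<phi>])
  have [measurable]: "\<psi> \<in> borel_measurable borel" "\<phi> \<in> borel_measurable borel"
    using \<psi> i\<phi> by (auto dest: borel_measurable_integrable)
  show f: "rapid_decay f" unfolding f_def by (rule rapid_decay_inverse_fourier[OF \<phi>])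
  show m [measurable]: "f \<in> borel_measurable borel" unfolding f_def by measurable
  have "integrable lborel (\<lambda>x. cmod (f x))"
    using rapid_decay_integrable[OF f m, of 0] by simp
  then have intf: "integrable lborel f"
    by (rule integrable_norm_cancel) measurable
  have AE: "AE y in lborel. \<psi> y = inverse_fourier \<phi> y"
    unfolding \<phi>_def by (rule AE_eq_inverse_fourier) (use \<psi> i\<phi> intf in \<open>auto simp: \<phi>_def f_def\<close>)
  have "fourier f \<xi> = \<phi> \<xi>" for \<xi>
    unfolding \<phi>_def fourier_cis
    by (rule integral_cong_AE) (use AE in \<open>auto simp: f_def\<close>)
  then have ff: "fourier f = \<phi>" by blast
  have AEf: "AE y in lborel. f y = inverse_fourier \<phi> y" by (simp add: f_def)
  show W: "wavelet_transform \<psi> \<psi> (x, h) = complex_of_real (sqrt \<bar>det h\<bar>) *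
          (\<integral>\<xi>. \<phi> \<xi> * cnj (\<phi> (transpose h *v \<xi>)) * cis (2 * pi * (x \<bullet> \<xi>)) \<partial>lborel)"
    if "invertible h"
    using wavelet_transform_fourier[OF \<psi> i\<phi> AE _ that] by (simp only: \<phi>_def[symmetric]) measurable
  show "wavelet_transform \<psi> \<psi> (x, h) = wavelet_transform f f (x, h)" if "invertible h"
    unfolding W[OF that] wavelet_transform_fourier[OF intf i\<phi> AEf m that] ff ..
qed

lemma one_plus_norm_le_mult:
  fixes a b :: "'a::real_normed_vector"
  shows "1 + norm (a - b) \<le> (1 + norm a) * (1 + norm b)"
proof -
  have "norm (a - b) \<le> norm a + norm b" by (rule norm_triangle_ineq4)
  moreover have "0 \<le> norm a * norm b" by simp
  moreover have "(1 + norm a) * (1 + norm b) = 1 + norm a + norm b + norm a * norm b"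
    by (simp add: algebra_simps)
  ultimately show ?thesis by linarith
qed

text \<open>With \<open>u = h\<^sup>-\<^sup>1 (y - x)\<close> one has \<open>x = y - h u\<close>, so \<open>(1 + norm x) ^ N\<close> is at most
  \<open>(1 + norm y) ^ N * (1 + norm h * K) ^ N * (1 + norm u) ^ N\<close>. The first factor is absorbed by the integrable
  decay of \<open>f y\<close> and the last one by the bounded decay of \<open>f u\<close>.\<close>
lemma wavelet_transform_decay:
  fixes f :: "real^'n \<Rightarrow> complex"
  assumes f: "rapid_decay f" and [measurable]: "f \<in> borel_measurable borel"
    and K: "\<And>(A :: real^'n^'n) (u :: real^'n). norm (A *v u) \<le> norm A * norm u * K" "K > 0"
  shows "\<exists>C\<ge>0. \<forall>x h. invertible h \<longrightarrow> (1 + norm x) ^ N * cmod (wavelet_transform f f (x, h))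
           \<le> C * (\<bar>det h\<bar> powr (- 1/2) * (1 + norm h * K) ^ N)"
proof -
  obtain B where B: "\<And>u. (1 + norm u) ^ N * cmod (f u) \<le> B"
    using f unfolding rapid_decay_def by blast
  have B0: "0 \<le> B" using order_trans[OF _ B[of 0]] by simp
  define I where "I = (\<integral>y. (1 + norm y) ^ N * cmod (f y) \<partial>lborel)"
  have I0: "I \<ge> 0" unfolding I_def by (rule integral_nonneg_AE) simp
  have "(1 + norm x) ^ N * cmod (wavelet_transform f f (x, h)) \<le> B * I * (\<bar>det h\<bar> powr (- 1/2) * (1 + norm h * K) ^ N)"
    if h: "invertible h" for x :: "real^'n" and h :: "real^'n^'n"
  proof -
    let ?k = "matrix_inv h" and ?c = "\<bar>det h\<bar> powr (- 1/2)"
    let ?w = "\<lambda>y. f y * cnj (complex_of_real ?c * f (?k *v (y - x)))"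
    let ?b = "\<lambda>y. (B * (?c * (1 + norm h * K) ^ N)) * ((1 + norm y) ^ N * cmod (f y))"
    have pt: "norm ((1 + norm x) ^ N *\<^sub>R ?w y) \<le> ?b y" for y
    proof -
      define u where "u = ?k *v (y - x)"
      have "h *v u = y - x"
        by (simp add: u_def matrix_vector_mul_assoc matrix_inv_inverse[OF h])
      then have "1 + norm x = 1 + norm (y - h *v u)" by simp
      also have "\<dots> \<le> (1 + norm y) * (1 + norm (h *v u))" by (rule one_plus_norm_le_mult)
      also have "1 + norm (h *v u) \<le> (1 + norm h * K) * (1 + norm u)"
        using K(1)[of h u] K(2) by (simp add: algebra_simps add_increasing)
      finally have "1 + norm x \<le> (1 + norm y) * ((1 + norm h * K) * (1 + norm u))"
        by (simp add: mult_left_mono)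
      then have "(1 + norm x) ^ N \<le> ((1 + norm y) * ((1 + norm h * K) * (1 + norm u))) ^ N"
        by (intro power_mono) auto
      then have "(1 + norm x) ^ N * (cmod (f y) * (?c * cmod (f u))) \<le>
          ((1 + norm y) ^ N * ((1 + norm h * K) ^ N * (1 + norm u) ^ N)) * (cmod (f y) * (?c * cmod (f u)))"
        by (intro mult_right_mono) (auto simp: power_mult_distrib)
      also have "\<dots> = ((1 + norm u) ^ N * cmod (f u)) * (?c * (1 + norm h * K) ^ N * ((1 + norm y) ^ N * cmod (f y)))"
        by (simp only: mult_ac)
      also have "\<dots> \<le> B * (?c * (1 + norm h * K) ^ N * ((1 + norm y) ^ N * cmod (f y)))"
        using K(2) by (intro mult_right_mono B) auto
      finally show ?thesis
        by (simp add: norm_mult u_def mult_ac)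
    qed
    have ib: "integrable lborel ?b"
      by (intro integrable_mult_right rapid_decay_integrable f) measurable
    have "(1 + norm x) ^ N * cmod (wavelet_transform f f (x, h)) = norm (\<integral>y. (1 + norm x) ^ N *\<^sub>R ?w y \<partial>lborel)"
      by (simp add: wavelet_transform_def L2_inner_def quasi_regular_def del: complex_cnj_mult)
    also have "\<dots> \<le> (\<integral>y. ?b y \<partial>lborel)"
    proof (rule Bochner_Integration.integral_norm_bound_integral[OF _ ib])
      show "integrable lborel (\<lambda>y. (1 + norm x) ^ N *\<^sub>R ?w y)"
      proof (rule Bochner_Integration.integrable_bound[OF ib])
        show "AE y in lborel. norm ((1 + norm x) ^ N *\<^sub>R ?w y) \<le> norm (?b y)"
          using order_trans[OF pt abs_ge_self] by (intro AE_I2) (simp only: real_norm_def)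
      qed measurable
    qed (rule pt)
    also have "\<dots> = B * I * (?c * (1 + norm h * K) ^ N)"
      unfolding integral_mult_right_zero I_def by (simp only: mult_ac)
    finally show ?thesis .
  qed
  then show ?thesis using B0 I0 by (intro exI[of _ "B * I"]) simp
qed

section \<open>Oscillation and weighted integrability\<close>

text \<open>Dominated convergence: \<open>\<phi>\<close> is continuous and bounded, and its first occurrence supplies the
  integrable majorant. This is how the wavelet transform is seen to be continuous in both variables.\<close>
lemma continuous_on_fourier_correlation:
  fixes \<phi> :: "real^'n \<Rightarrow> complex" and H :: "(real^'n^'n) set"
  assumes \<phi>: "\<phi> \<in> test_functions UNIV"
  shows "continuous_on (UNIV \<times> H)
    (\<lambda>z. \<integral>\<xi>. \<phi> \<xi> * cnj (\<phi> (transpose (snd z) *v \<xi>)) * cis (2 * pi * (fst z \<bullet> \<xi>)) \<partial>lborel)"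
proof -
  have c: "continuous_on UNIV \<phi>" by (rule test_functions_continuous[OF \<phi>])
  have [measurable]: "\<phi> \<in> borel_measurable borel"
    by (rule borel_measurable_continuous_onI[OF c])
  obtain B where B: "B > 0" "\<And>\<xi>. cmod (\<phi> \<xi>) \<le> B"
    using test_functions_bounded[OF \<phi>] by blast
  let ?F = "\<lambda>z \<xi>. \<phi> \<xi> * cnj (\<phi> (transpose (snd z) *v \<xi>)) * cis (2 * pi * (fst z \<bullet> \<xi>))"
  have cF: "continuous_on UNIV (\<lambda>z. ?F z \<xi>)" for \<xi>
    by (intro continuous_intros continuous_on_compose2[OF c]) auto
  have mF: "?F z \<in> borel_measurable borel" for z :: "(real^'n) \<times> (real^'n^'n)"
    by measurable
  show ?thesis
    unfolding continuous_on_sequentially o_def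
  proof (intro allI ballI impI, elim conjE)
    fix zs :: "nat \<Rightarrow> (real^'n) \<times> (real^'n^'n)" and z
    assume lim: "zs \<longlonglongrightarrow> z"
    show "(\<lambda>k. \<integral>\<xi>. ?F (zs k) \<xi> \<partial>lborel) \<longlonglongrightarrow> (\<integral>\<xi>. ?F z \<xi> \<partial>lborel)"
    proof (rule integral_dominated_convergence[where w="\<lambda>\<xi>. cmod (\<phi> \<xi>) * B"])
      show "integrable lborel (\<lambda>\<xi>. cmod (\<phi> \<xi>) * B)"
        by (intro integrable_mult_left integrable_norm test_functions_integrable \<phi>)
      show "AE \<xi> in lborel. (\<lambda>k. ?F (zs k) \<xi>) \<longlonglongrightarrow> ?F z \<xi>"
        using continuous_on_tendsto_compose[OF cF lim] by (intro AE_I2) simp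
      show "AE \<xi> in lborel. norm (?F (zs k) \<xi>) \<le> cmod (\<phi> \<xi>) * B" for k
        using B(2) by (intro AE_I2) (simp add: norm_mult mult_left_mono del: transpose_matrix_vector)
      show "?F z \<in> borel_measurable lborel" using mF by simp
      show "?F (zs k) \<in> borel_measurable lborel" for k using mF by simp
    qed
  qed
qed

context closed_matrix_subgroup
begin

text \<open>Relatively open subsets of the group are measurable because the Borel sets of the product space
  are generated by rectangles; so lower semicontinuity implies measurability.\<close>
lemma borel_measurable_sd_haar:
  assumes sets: "sets \<mu> = sets (restrict_space borel H)"
    and F: "\<And>a. \<exists>T. open T \<and> {z \<in> UNIV \<times> H. a < F z} = (UNIV \<times> H) \<inter> T"
  shows "(F :: (real^'n) \<times> (real^'n^'n) \<Rightarrow> real) \<in> borel_measurable (sd_haar \<mu>)"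
proof -
  have sp: "space \<mu> = H" using sets_eq_imp_space_eq[OF sets] by (simp add: space_restrict_space)
  have ssd: "sets (sd_haar \<mu>) = sets (lborel \<Otimes>\<^sub>M \<mu>)" by (simp add: sd_haar_def)
  have ssp: "space (sd_haar \<mu>) = UNIV \<times> H"
    by (simp add: sd_haar_def space_pair_measure sp)
  have "(\<lambda>h. h) \<in> measurable \<mu> borel"
    unfolding measurable_cong_sets[OF sets refl] by (intro measurable_restrict_space1) simp
  then have "(\<lambda>z. (fst z, snd z)) \<in> measurable (lborel \<Otimes>\<^sub>M \<mu>) (borel \<Otimes>\<^sub>M borel)"
    by measurable
  then have id: "(\<lambda>z. z) \<in> measurable (lborel \<Otimes>\<^sub>M \<mu>) borel"
    by (simp add: borel_prod)
  show ?thesis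
    unfolding borel_measurable_iff_greater
  proof
    fix a
    obtain T where T: "open T" "{z \<in> UNIV \<times> H. a < F z} = (UNIV \<times> H) \<inter> T" using F by blast
    have "(\<lambda>z. z) -` T \<inter> space (lborel \<Otimes>\<^sub>M \<mu>) \<in> sets (lborel \<Otimes>\<^sub>M \<mu>)"
      by (rule measurable_sets[OF id]) (use T in auto)
    moreover have "(\<lambda>z. z) -` T \<inter> space (lborel \<Otimes>\<^sub>M \<mu>) = {z \<in> space (sd_haar \<mu>). a < F z}"
      unfolding ssp T(2) by (auto simp: space_pair_measure sp)
    ultimately show "{z \<in> space (sd_haar \<mu>). a < F z} \<in> sets (sd_haar \<mu>)"
      by (simp add: ssd)
  qed
qed

text \<open>The oscillation exceeds \<open>a\<close> at \<open>z\<close> if and only if one of the continuous functions under the supremum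
  does. The bound on \<open>W\<close> is what makes the real supremum the least upper bound.\<close>
lemma oscillation_greater_open:
  assumes W: "continuous_on (UNIV \<times> H) W" and U: "U \<subseteq> UNIV \<times> H" "U \<noteq> {}"
    and bound: "\<And>z. z \<in> UNIV \<times> H \<Longrightarrow> cmod (W z) \<le> C"
  shows "\<exists>T. open T \<and> {z \<in> UNIV \<times> H. a < oscillation U W z} = (UNIV \<times> H) \<inter> T"
proof -
  have mem: "sd_mult z y \<in> UNIV \<times> H" if "z \<in> UNIV \<times> H" "y \<in> UNIV \<times> H" for z y
    using that by (auto simp: sd_mult_def mult_in)
  have "bdd_above ((\<lambda>y. cmod (W z - W (sd_mult z y))) ` U)" if z: "z \<in> UNIV \<times> H" for z
  proof (rule bdd_aboveI2)
    fix y assume "y \<in> U"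
    then have "cmod (W (sd_mult z y)) \<le> C" using bound mem[OF z] U by blast
    then show "cmod (W z - W (sd_mult z y)) \<le> C + C"
      using norm_triangle_ineq4[of "W z" "W (sd_mult z y)"] bound[OF z] by linarith
  qed
  then have "a < oscillation U W z \<longleftrightarrow> (\<exists>y\<in>U. a < cmod (W z - W (sd_mult z y)))"
    if "z \<in> UNIV \<times> H" for z
    unfolding oscillation_def by (rule less_cSUP_iff[OF U(2)]) (rule that)
  then have "{z \<in> UNIV \<times> H. a < oscillation U W z}
     = (\<Union>y\<in>U. {z \<in> UNIV \<times> H. cmod (W z - W (sd_mult z y)) \<in> {a<..}})"
    by (simp only: greaterThan_iff) blast
  moreover have "openin (top_of_set (UNIV \<times> H)) (\<Union>y\<in>U. {z \<in> UNIV \<times> H. cmod (W z - W (sd_mult z y)) \<in> {a<..}})"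
  proof (rule openin_Union, clarify)
    fix yx yh assume "(yx, yh) \<in> U"
    then have y: "(yx, yh) \<in> UNIV \<times> H" using U by blast
    have "continuous_on (UNIV \<times> H) (\<lambda>z. sd_mult z (yx, yh))"
      unfolding sd_mult_def by (intro continuous_intros)
    then have "continuous_on (UNIV \<times> H) (\<lambda>z. W (sd_mult z (yx, yh)))"
      by (rule continuous_on_compose2[OF W]) (use mem[OF _ y] in blast)
    then have "continuous_on (UNIV \<times> H) (\<lambda>z. cmod (W z - W (sd_mult z (yx, yh))))"
      by (intro continuous_intros W)
    then have "openin (top_of_set (UNIV \<times> H)) ((UNIV \<times> H) \<inter> (\<lambda>z. cmod (W z - W (sd_mult z (yx, yh)))) -` {a<..})"
      by (rule continuous_openin_preimage_gen) simp
    moreover have "(UNIV \<times> H) \<inter> (\<lambda>z. cmod (W z - W (sd_mult z (yx, yh)))) -` {a<..}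
       = {z \<in> UNIV \<times> H. cmod (W z - W (sd_mult z (yx, yh))) \<in> {a<..}}" by blast
    ultimately show "openin (top_of_set (UNIV \<times> H)) {z \<in> UNIV \<times> H. cmod (W z - W (sd_mult z (yx, yh))) \<in> {a<..}}"
      by simp
  qed
  ultimately show ?thesis unfolding openin_open by metis
qed

text \<open>Balls of \<open>H\<close> around \<open>1\<close> need not be closed in the space of all matrices, since \<open>H\<close> may approach
  singular matrices; containment in a \<open>group_ball\<close> excludes this and makes them compact.\<close>
lemma rel_compact_nbhd_cball:
  assumes r: "r > 0" and R: "H \<inter> cball (mat 1) r \<subseteq> group_ball R"
  shows "rel_compact_nbhd H (cball 0 1 \<times> (H \<inter> cball (mat 1) r))"
proof -
  let ?U = "cball (0::real^'n) 1 \<times> (H \<inter> cball (mat 1) r)"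
  let ?X = "top_of_set (sd_carrier H)"
  have sub: "?U \<subseteq> sd_carrier H" by (auto simp: sd_carrier_def)
  have "H \<inter> cball (mat 1) r = group_ball R \<inter> cball (mat 1) r"
    using R group_ball_subset by blast
  then have "compact (H \<inter> cball (mat 1) r)"
    using compact_Int_closed[OF compact_group_ball closed_cball] by simp
  then have comp: "compact ?U" by (intro compact_Times compact_cball)
  have "closedin ?X ?U"
    using sub compact_imp_closed[OF comp] by (rule closed_subset)
  then have cl: "?X closure_of ?U = ?U" by (rule closure_of_closedin)
  have "sd_one \<in> ?X interior_of ?U"
    unfolding interior_of_def mem_Collect_eq
  proof (intro exI conjI)
    show "openin ?X (sd_carrier H \<inter> (ball 0 1 \<times> ball (mat 1) r))"
      by (intro openin_open_Int open_Times open_ball)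
    show "sd_one \<in> sd_carrier H \<inter> (ball 0 1 \<times> ball (mat 1) r)"
      using r one_in by (simp add: sd_one_def sd_carrier_def)
    show "sd_carrier H \<inter> (ball 0 1 \<times> ball (mat 1) r) \<subseteq> ?U"
      using ball_subset_cball by (auto simp: sd_carrier_def)
  qed
  then show ?thesis
    using sub comp unfolding rel_compact_nbhd_def cl by (simp add: compactin_subtopology)
qed

text \<open>The density \<open>1 / \<bar>det h\<bar>\<close> is bounded on \<open>group_ball R\<close>, so the integral is at most a constant times the
  product of a convergent integral over \<open>x\<close> and the finite Haar measure of \<open>group_ball R\<close>. The
  exhaustion makes the Haar measure sigma-finite, as the iterated integral requires.\<close>
lemma L1_weightedI_compact_support:
  fixes F :: "(real^'n) \<times> (real^'n^'n) \<Rightarrow> real"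
  assumes haar: "left_haar_measure H \<mu>"
    and meas: "F \<in> borel_measurable (sd_haar \<mu>)"
    and bound: "\<And>x h. h \<in> group_ball R \<Longrightarrow> \<bar>F (x, h)\<bar> * v (x, h) \<le> C * inverse ((1 + norm x) ^ (2 * CARD('n)))"
    and supp: "\<And>x h. h \<in> H \<Longrightarrow> h \<notin> group_ball R \<Longrightarrow> F (x, h) = 0"
  shows "F \<in> L1_weighted \<mu> v"
proof -
  have sets: "sets \<mu> = sets (restrict_space borel H)"
    and fin: "\<And>K. compact K \<Longrightarrow> K \<subseteq> H \<Longrightarrow> emeasure \<mu> K < \<infinity>"
    using haar by (auto simp: left_haar_measure_def)
  have sp: "space \<mu> = H" using sets_eq_imp_space_eq[OF sets] by (simp add: space_restrict_space)
  have ball_sets: "group_ball S \<in> sets \<mu>" for S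
  proof -
    have "group_ball S = group_ball S \<inter> H" using group_ball_subset by blast
    then show ?thesis
      unfolding sets sets_restrict_space using borel_compact[OF compact_group_ball[of S]] by blast
  qed
  have ball_fin: "emeasure \<mu> (group_ball S) < \<infinity>" for S
    by (intro fin compact_group_ball group_ball_subset)
  have "sigma_finite_measure \<mu>"
  proof
    show "\<exists>A. countable A \<and> A \<subseteq> sets \<mu> \<and> \<Union> A = space \<mu> \<and> (\<forall>a\<in>A. emeasure \<mu> a \<noteq> \<infinity>)"
    proof (intro exI conjI ballI)
      let ?A = "range (\<lambda>n::nat. group_ball (real n))"
      show "countable ?A" by simp
      show "?A \<subseteq> sets \<mu>" using ball_sets by blast
      show "\<Union>?A = space \<mu>"
        using group_ball_exhausts group_ball_subset unfolding sp by blast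
      show "emeasure \<mu> a \<noteq> \<infinity>" if "a \<in> ?A" for a
        using that ball_fin by (auto simp: less_top[symmetric])
    qed
  qed
  then interpret \<mu>: sigma_finite_measure \<mu> .
  have "det \<in> borel_measurable (borel :: (real^'n^'n) measure)"
    by (intro borel_measurable_continuous_onI continuous_intros)
  then have [measurable]: "det \<in> borel_measurable \<mu>"
    unfolding measurable_cong_sets[OF sets refl] by (rule measurable_restrict_space1)
  have "continuous_on H (\<lambda>h. 1 / \<bar>det h\<bar>)"
    by (intro continuous_intros) (simp add: det_nz)
  then obtain D where D: "D \<ge> 0" "\<And>h. h \<in> group_ball R \<Longrightarrow> 1 / \<bar>det h\<bar> \<le> D"
    using group_ball_bounds_continuous[of "\<lambda>h. 1 / \<bar>det h\<bar>" R] by fastforce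
  let ?p = "\<lambda>x::real^'n. inverse ((1 + norm x) ^ (2 * CARD('n)))"
  define G where "G z = ennreal (\<bar>C\<bar> * ?p (fst z)) * indicator (group_ball R) (snd z)" for z :: "(real^'n) \<times> (real^'n^'n)"
  have [measurable]: "indicator (group_ball R) \<in> borel_measurable \<mu>"
    using ball_sets by (rule borel_measurable_indicator)
  have Gm [measurable]: "G \<in> borel_measurable (lborel \<Otimes>\<^sub>M \<mu>)"
    unfolding G_def by measurable
  have "(\<integral>\<^sup>+z. ennreal (norm (F z) * v z) \<partial>sd_haar \<mu>) \<le> (\<integral>\<^sup>+z. G z \<partial>sd_haar \<mu>)"
  proof (rule nn_integral_mono)
    fix z assume "z \<in> space (sd_haar \<mu>)"
    then obtain x h where z: "z = (x, h)" and h: "h \<in> H"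
      by (cases z) (auto simp: sd_haar_def space_pair_measure sp)
    show "ennreal (norm (F z) * v z) \<le> G z"
    proof (cases "h \<in> group_ball R")
      case True
      have "\<bar>F (x, h)\<bar> * v (x, h) \<le> \<bar>C\<bar> * ?p x"
        using bound[OF True, of x] by (rule order_trans) (intro mult_right_mono, auto)
      then show ?thesis using True by (simp add: G_def z ennreal_leI)
    next
      case False
      then show ?thesis using supp[OF h] by (simp add: z)
    qed
  qed
  also have "(\<integral>\<^sup>+z. G z \<partial>sd_haar \<mu>) = (\<integral>\<^sup>+z. (case z of (x, h) \<Rightarrow> ennreal (1 / \<bar>det h\<bar>)) * G z \<partial>(lborel \<Otimes>\<^sub>M \<mu>))"
    unfolding sd_haar_def by (rule nn_integral_density) measurable
  also have "\<dots> \<le> (\<integral>\<^sup>+z. ennreal D * G z \<partial>(lborel \<Otimes>\<^sub>M \<mu>))"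
  proof (rule nn_integral_mono)
    fix z :: "(real^'n) \<times> (real^'n^'n)"
    show "(case z of (x, h) \<Rightarrow> ennreal (1 / \<bar>det h\<bar>)) * G z \<le> ennreal D * G z"
      using D(2)[of "snd z"] 
      by (cases "snd z \<in> group_ball R") (auto simp: G_def split_beta intro!: mult_right_mono ennreal_leI)
  qed
  also have "\<dots> = ennreal D * (\<integral>\<^sup>+z. G z \<partial>(lborel \<Otimes>\<^sub>M \<mu>))"
    by (rule nn_integral_cmult) measurable
  also have "(\<integral>\<^sup>+z. G z \<partial>(lborel \<Otimes>\<^sub>M \<mu>)) = (\<integral>\<^sup>+x. (\<integral>\<^sup>+h. G (x, h) \<partial>\<mu>) \<partial>lborel)"
    by (rule \<mu>.nn_integral_fst[symmetric]) measurable
  also have "\<dots> = (\<integral>\<^sup>+x. ennreal (\<bar>C\<bar> * ?p x) * emeasure \<mu> (group_ball R) \<partial>lborel)"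
    unfolding G_def fst_conv snd_conv
    by (simp add: nn_integral_cmult_indicator ball_sets)
  also have "\<dots> = (\<integral>\<^sup>+x. ennreal (\<bar>C\<bar> * ?p x) \<partial>lborel) * emeasure \<mu> (group_ball R)"
    by (rule nn_integral_multc) measurable
  also have "ennreal D * \<dots> < \<infinity>"
  proof -
    have "integrable lborel (\<lambda>x. \<bar>C\<bar> * ?p x)"
      using integrable_inverse_power_norm[where 'a="real^'n"] by (intro integrable_mult_right) simp
    then have "(\<integral>\<^sup>+x. ennreal (\<bar>C\<bar> * ?p x) \<partial>lborel) < \<infinity>"
      unfolding integrable_iff_bounded by simp
    then show ?thesis using ball_fin[of R] by (simp add: ennreal_mult_less_top)
  qed
  finally show ?thesis using meas by (simp add: L1_weighted_def)
qed

end

lemma one_plus_norm_power_mono: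
  "s \<le> real M \<Longrightarrow> (1 + norm x) powr s \<le> (1 + norm x) ^ M"
proof -
  assume "s \<le> real M"
  then have "(1 + norm x) powr s \<le> (1 + norm x) powr real M"
    by (intro powr_mono) auto
  also have "\<dots> = (1 + norm x) ^ M"
    by (intro powr_realpow) (simp add: add_pos_nonneg)
  finally show ?thesis .
qed

theorem lemma2p7:
  fixes H :: "(real^'n^'n) set"
    and \<mu> :: "(real^'n^'n) measure"
    and Orb :: "(real^'n) set"
    and v :: "(real^'n) \<times> (real^'n^'n) \<Rightarrow> real"
    and w :: "real^'n^'n \<Rightarrow> real"
    and s :: real
    and \<psi> :: "real^'n \<Rightarrow> complex"
  assumes "CARD('n) > 1"
    and "admissible_dilation_group H \<mu>"
    and "open_dual_orbit H Orb"
    and "weight_on (sd_carrier H) sd_mult v"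
    and "s \<ge> 0"
    and "weight_on H (**) w"
    and "\<And>x h. h \<in> H \<Longrightarrow> v (x, h) \<le> (1 + norm x) powr s * w h"
    and "\<psi> \<in> fourier_test_functions Orb"
  shows "\<exists>U. rel_compact_nbhd H U \<and>
           oscillation U (wavelet_transform \<psi> \<psi>) \<in> L1_weighted \<mu> v"
proof -
  have haar: "left_haar_measure H \<mu>"
    using assms(2) by (simp add: admissible_dilation_group_def)
  interpret closed_matrix_subgroup H
    using assms(2) by unfold_locales (simp add: admissible_dilation_group_def)
  define \<phi> where "\<phi> = fourier \<psi>"
  define f where "f = inverse_fourier \<phi>"
  define W where "W = wavelet_transform \<psi> \<psi>"
  \<comment> \<open>From here on \<open>f\<close> is the rapidly decreasing representative of \<open>\<psi>\<close>.\<close>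
  note rep = fourier_test_function_representative[OF assms(8), folded \<phi>_def, folded f_def W_def]
  have "\<phi> \<in> test_functions Orb"
    using assms(8) by (simp add: fourier_test_functions_def \<phi>_def)
  then have \<phi>: "\<phi> \<in> test_functions UNIV" using test_functions_UNIV by blast
  define K where "K = closure {\<xi>. \<phi> \<xi> \<noteq> 0}"
  have K: "compact K" "K \<subseteq> Orb"
    using \<open>\<phi> \<in> test_functions Orb\<close> by (auto simp: test_functions_def K_def)
  have K0: "\<phi> \<xi> = 0" if "\<xi> \<notin> K" for \<xi>
    using that closure_subset[of "{\<xi>. \<phi> \<xi> \<noteq> 0}"] by (auto simp: K_def)

  obtain \<xi>\<^sub>0 where \<xi>\<^sub>0: "Orb = dual_orbit H \<xi>\<^sub>0"
    using assms(3) unfolding open_dual_orbit_def by blast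
  have "transpose (mat 1) *v \<xi>\<^sub>0 \<in> Orb" unfolding \<xi>\<^sub>0 dual_orbit_def using one_in by (rule imageI)
  then have "\<xi>\<^sub>0 \<in> Orb" unfolding dual_action_one .
  then obtain R0 where R0: "\<And>h \<eta>. h \<in> H \<Longrightarrow> \<eta> \<in> K \<Longrightarrow> transpose h *v \<eta> \<in> K \<Longrightarrow> h \<in> group_ball R0"
    using dual_action_proper[of \<xi>\<^sub>0 K] assms(3) K unfolding open_dual_orbit_def \<xi>\<^sub>0 by blast
  have W_supp: "W (x, h) = 0" if h: "h \<in> H" "h \<notin> group_ball R0" for x h
  proof -
    have zero: "\<phi> \<xi> * cnj (\<phi> (transpose h *v \<xi>)) = 0" for \<xi>
      using R0[OF h(1), of \<xi>] h(2) K0[of \<xi>] K0[of "transpose h *v \<xi>"] by fastforce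
    show ?thesis unfolding rep(3)[OF invertible_in[OF h(1)]] zero by simp
  qed

  have W_cont: "continuous_on (UNIV \<times> H) W"
  proof -
    have "continuous_on (UNIV \<times> H) (\<lambda>z. complex_of_real (sqrt \<bar>det (snd z)\<bar>) *
      (\<integral>\<xi>. \<phi> \<xi> * cnj (\<phi> (transpose (snd z) *v \<xi>)) * cis (2 * pi * (fst z \<bullet> \<xi>)) \<partial>lborel))"
      by (intro continuous_on_mult continuous_on_fourier_correlation \<phi>) (intro continuous_intros)
    then show ?thesis
      by (rule continuous_on_cong[THEN iffD1, OF refl, rotated]) (auto simp: rep(3) invertible_in simp del: transpose_matrix_vector)
  qed

  obtain M :: nat where M: "s \<le> real M" using real_arch_simple by blast
  \<comment> \<open>\<open>M\<close> powers of \<open>1 + norm x\<close> are spent on the weight and the other \<open>2 * CARD('n)\<close> make the integral over \<open>x\<close>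
     converge.\<close>
  define N where "N = M + 2 * CARD('n)"
  obtain L where L: "L > 0" "\<And>(A :: real^'n^'n) (u :: real^'n). norm (A *v u) \<le> norm A * norm u * L"
    using bounded_bilinear.pos_bounded[OF bounded_bilinear_matrix_vector_mult] by blast
  obtain C where C: "C \<ge> 0" "\<And>x h. invertible h \<Longrightarrow>
      (1 + norm x) ^ N * cmod (wavelet_transform f f (x, h)) \<le> C * (\<bar>det h\<bar> powr (- 1/2) * (1 + norm h * L) ^ N)"
    using wavelet_transform_decay[OF rep(1,2) L(2,1)] by blast
  have "continuous_on H (\<lambda>h. C * (\<bar>det h\<bar> powr (- 1/2) * (1 + norm h * L) ^ N))"
    by (intro continuous_intros) (simp add: det_nz)
  from group_ball_bounds_continuous[OF this, of R0] obtain C1 where C1: "C1 \<ge> 0"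
      "\<And>h. h \<in> group_ball R0 \<Longrightarrow> C * (\<bar>det h\<bar> powr (- 1/2) * (1 + norm h * L) ^ N) \<le> C1"
    by (blast dest: abs_le_D1)
  have W_decay: "(1 + norm x) ^ N * cmod (W (x, h)) \<le> C1" if h: "h \<in> H" for x h
  proof (cases "h \<in> group_ball R0")
    case True
    show ?thesis
      unfolding rep(4)[OF invertible_in[OF h]]
      using C(2)[OF invertible_in[OF h]] C1(2)[OF True] by (rule order_trans)
  next
    case False
    then show ?thesis using W_supp[OF h] C1(1) by simp
  qed
  have W_bound: "cmod (W z) \<le> C1" if zH: "z \<in> UNIV \<times> H" for z
  proof -
    obtain x h where z: "z = (x, h)" "h \<in> H" using zH by blast
    have "1 * cmod (W z) \<le> (1 + norm x) ^ N * cmod (W z)"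
      by (intro mult_right_mono one_le_power) auto
    then show ?thesis using W_decay[OF z(2), of x] unfolding z(1) by linarith
  qed

  obtain r R1 where r: "r > 0" and R1: "H \<inter> cball (mat 1) r \<subseteq> group_ball R1"
    using ball_one_subset_group_ball by blast
  define U where "U = cball (0::real^'n) 1 \<times> (H \<inter> cball (mat 1) r)"
  have U: "rel_compact_nbhd H U"
    unfolding U_def by (rule rel_compact_nbhd_cball[OF r R1])
  have U_sub: "U \<subseteq> UNIV \<times> H" by (auto simp: U_def)
  have one_U: "(0, mat 1) \<in> U" using one_in r by (simp add: U_def)
  then have U_ne: "U \<noteq> {}" by blast

  \<comment> \<open>If \<open>h k\<close> lies in \<open>group_ball R0\<close> for some \<open>(u, k) \<in> U\<close>, then \<open>h = (h k) k\<^sup>-\<^sup>1\<close> lies in \<open>group_ball T\<close>.\<close>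
  obtain T where T: "\<And>g h. g \<in> group_ball R0 \<Longrightarrow> h \<in> group_ball R1 \<Longrightarrow> g ** h \<in> group_ball T"
    using group_ball_mult[of R0 R1] by blast
  have W_near: "W (sd_mult (x, h) y) = 0" if h: "h \<in> H" "h \<notin> group_ball T" and y: "y \<in> U" for x h y
  proof -
    obtain u k where yuk: "y = (u, k)" "k \<in> H" "k \<in> group_ball R1"
      using y R1 by (auto simp: U_def)
    have "h ** k \<notin> group_ball R0"
    proof
      assume "h ** k \<in> group_ball R0"
      then have "h ** k ** matrix_inv k \<in> group_ball T"
        using T group_ball_inv[OF yuk(3)] by blast
      then have "h \<in> group_ball T"
        by (simp add: matrix_mul_assoc[symmetric] inv_right yuk(2))
      then show False using h(2) by contradiction
    qed
    then show ?thesis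
      using W_supp[OF mult_in[OF h(1) yuk(2)]] by (simp add: sd_mult_def yuk(1))
  qed
  have osc_supp: "oscillation U W (x, h) = 0" if h: "h \<in> H" "h \<notin> group_ball T" for x h
  proof -
    have "sd_mult (x, h) (0, mat 1) = (x, h)" by (simp add: sd_mult_def)
    then have "W (x, h) = 0" using W_near[OF h one_U] by metis
    then show ?thesis
      unfolding oscillation_def using W_near[OF h] U_ne by (simp cong: SUP_cong)
  qed

  \<comment> \<open>The extra factor compares \<open>1 + norm x\<close> with \<open>1 + norm (x + h *v u)\<close> for \<open>norm u \<le> 1\<close>.\<close>
  define C2 where "C2 = C1 + C1 * (1 + \<bar>T\<bar> * L) ^ N"
  have osc_decay: "(1 + norm x) ^ N * \<bar>oscillation U W (x, h)\<bar> \<le> C2" if h: "h \<in> group_ball T" for x h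
  proof -
    have hH: "h \<in> H" using h group_ball_subset by blast
    have pos: "0 < (1 + norm x) ^ N" by (intro zero_less_power) (simp add: add_pos_nonneg)
    have le: "cmod (W (x, h) - W (sd_mult (x, h) y)) \<le> C2 / (1 + norm x) ^ N" if y: "y \<in> U" for y
    proof -
      obtain u k where yuk: "y = (u, k)" "norm u \<le> 1" "k \<in> H"
        using y by (auto simp: U_def)
      have "norm (h *v u) \<le> norm h * norm u * L" by (rule L(2))
      also have "\<dots> \<le> \<bar>T\<bar> * 1 * L"
        using h yuk(2) L(1) by (intro mult_right_mono mult_mono) (auto simp: group_ball_def)
      finally have hu: "norm (h *v u) \<le> \<bar>T\<bar> * L" by simp
      have "1 + norm x = 1 + norm (x + h *v u - h *v u)" by simp
      also have "\<dots> \<le> (1 + norm (x + h *v u)) * (1 + norm (h *v u))" by (rule one_plus_norm_le_mult)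
      also have "\<dots> \<le> (1 + norm (x + h *v u)) * (1 + \<bar>T\<bar> * L)"
        using hu by (intro mult_left_mono) auto
      finally have "(1 + norm x) ^ N \<le> ((1 + norm (x + h *v u)) * (1 + \<bar>T\<bar> * L)) ^ N"
        by (intro power_mono) auto
      then have "(1 + norm x) ^ N * cmod (W (sd_mult (x, h) y)) \<le>
          ((1 + norm (x + h *v u)) * (1 + \<bar>T\<bar> * L)) ^ N * cmod (W (sd_mult (x, h) y))"
        by (intro mult_right_mono) auto
      also have "\<dots> = ((1 + norm (x + h *v u)) ^ N * cmod (W (x + h *v u, h ** k))) * (1 + \<bar>T\<bar> * L) ^ N"
        by (simp add: power_mult_distrib sd_mult_def yuk(1))
      also have "\<dots> \<le> C1 * (1 + \<bar>T\<bar> * L) ^ N"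
        using L(1) by (intro mult_right_mono W_decay mult_in hH yuk(3)) auto
      finally have "(1 + norm x) ^ N * (cmod (W (x, h)) + cmod (W (sd_mult (x, h) y))) \<le> C2"
        using W_decay[OF hH, of x] by (simp add: C2_def distrib_left)
      then have "cmod (W (x, h)) + cmod (W (sd_mult (x, h) y)) \<le> C2 / (1 + norm x) ^ N"
        using pos by (simp add: pos_le_divide_eq mult.commute)
      then show ?thesis using norm_triangle_ineq4 order_trans by blast
    qed
    have "oscillation U W (x, h) \<le> C2 / (1 + norm x) ^ N"
      unfolding oscillation_def by (rule cSUP_least[OF U_ne le])
    moreover have "0 \<le> oscillation U W (x, h)"
      unfolding oscillation_def using le
      by (intro cSUP_upper2[OF _ one_U]) (auto intro!: bdd_aboveI2)
    ultimately show ?thesis using pos by (simp add: pos_le_divide_eq mult.commute)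
  qed

  have "continuous_on H w" using assms(6) by (simp add: weight_on_def)
  from group_ball_bounds_continuous[OF this, of T]
  obtain B where B: "B \<ge> 0" "\<And>h. h \<in> group_ball T \<Longrightarrow> w h \<le> B"
    by (blast dest: abs_le_D1)
  have "oscillation U W \<in> L1_weighted \<mu> v"
  proof (rule L1_weightedI_compact_support[OF haar])
    show "oscillation U W \<in> borel_measurable (sd_haar \<mu>)"
      using haar unfolding left_haar_measure_def
      by (intro borel_measurable_sd_haar oscillation_greater_open[OF W_cont U_sub U_ne W_bound]) auto
    show "oscillation U W (x, h) = 0" if "h \<in> H" "h \<notin> group_ball T" for x h
      using osc_supp that .
    show "\<bar>oscillation U W (x, h)\<bar> * v (x, h) \<le> C2 * B * inverse ((1 + norm x) ^ (2 * CARD('n)))"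
      if h: "h \<in> group_ball T" for x h
    proof -
      have hH: "h \<in> H" using h group_ball_subset by blast
      have pos: "0 < (1 + norm x) ^ (2 * CARD('n))" by (intro zero_less_power) (simp add: add_pos_nonneg)
      have "v (x, h) \<le> (1 + norm x) powr s * w h" by (rule assms(7)[OF hH])
      also have "\<dots> \<le> (1 + norm x) ^ M * B"
        using B h one_plus_norm_power_mono[OF M, of x] assms(6) hH
        by (intro mult_mono) (auto simp: weight_on_def less_imp_le)
      finally have "\<bar>oscillation U W (x, h)\<bar> * v (x, h) \<le> \<bar>oscillation U W (x, h)\<bar> * ((1 + norm x) ^ M * B)"
        by (intro mult_left_mono) auto
      then have "\<bar>oscillation U W (x, h)\<bar> * v (x, h) * (1 + norm x) ^ (2 * CARD('n))
          \<le> \<bar>oscillation U W (x, h)\<bar> * ((1 + norm x) ^ M * B) * (1 + norm x) ^ (2 * CARD('n))"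
        using pos by (intro mult_right_mono) auto
      also have "\<dots> = (1 + norm x) ^ N * \<bar>oscillation U W (x, h)\<bar> * B"
        by (simp add: N_def power_add mult_ac)
      also have "\<dots> \<le> C2 * B" by (intro mult_right_mono osc_decay h B(1))
      finally show ?thesis using pos by (simp add: field_simps)
    qed
  qed
  with U show ?thesis unfolding W_def by blast
qed

end
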